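(* Let $\mathcal{F}_{w_{\max}}$ be the family of all weighted configurations in the congested clique (with input graph not necessarily connected) with natural-number edge weights at most $w_{\max}$, in which a subset $T$ of the input graph's edges is specified locally at the nodes. Let $\mathrm{MST}$ be the predicate which is true if and only if the specification of $T$ is consistent between the endpoints of each edge and $T$ is a minimum spanning tree of the input graph (if the input graph is disconnected: the union of minimum spanning trees of all its connected components). Then the verification complexity of $(\mathcal{F}_{w_{\max}},\mathrm{MST})$ in the broadcast clique model is $\Theta(\log n+\log w_{\max})$, where $n$ is the number of nodes.
   Context: Congested clique: the communication network is the complete graph on $n$ nodes; each node has a unique identifier (polynomially bounded in $n$) and $n-1$ ports, one per other node. An input graph $G=(V,E,w)$ with $|V|=n$ is mapped one-to-one to the nodes of the clique. The state of each node specifies for each port whether the communication edge on that port is in $E$, if so its weight, and whether it is in $T$. The specification of $E$ and of the weights is reliable and consistent between the two endpoints of each edge; the specification of $T$ need not be consistent. Let $\mathcal{F}$ be a family of configurations and $\mathcal{P}$ a boolean predicate on $\mathcal{F}$; a configuration is legal if $\mathcal{P}$ is true on it. A (deterministic) proof-labeling scheme (PLS) for $(\mathcal{F},\mathcal{P})$ is a pair (prover, verifier). Given a legal configuration, the prover assigns each node a label (a bit string, of any length). The verifier is a distributed one-round algorithm over the clique; in the broadcast clique model each node, as a function of its state and label, sends one and the same message (bit string) on all its $n-1$ ports, then, as a function of its state, its label and the messages received on each of its ports, outputs True or False. A configuration with labels is accepted if all nodes output True, and otherwise rejected. Requirements: every legal configuration with the prover's labels is accepted; every illegal configuration in $\mathcal{F}$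 is rejected for every label assignment. The verification complexity of a PLS is the maximal length of a message sent by the verifier under the prover's labels in legal configurations; that of a problem is the minimum over all PLSs for it in the given model, here as a function of $n$ and $w_{\max}$ (worst case over legal configurations with $n$ nodes). Hidden constants are universal (up to the exponent of the polynomial identifier bound) and $n$ is sufficiently large. *)

theory Defs
  imports "HOL-Library.Extended_Real"
begin

section \<open>Minimum spanning trees\<close>

text \<open>Undirected simple graphs are given by a vertex set and a set of two-element edges.\<close>

definition edge_rel :: "nat set set \<Rightarrow> (nat \<times> nat) set" where
  "edge_rel E = {(u, v). {u, v} \<in> E}"

definition induced_edges :: "nat set \<Rightarrow> nat set set \<Rightarrow> nat set set" where
  "induced_edges U E = {e \<in> E. e \<subseteq> U}"

definition graph_components :: "nat set \<Rightarrow> nat set set \<Rightarrow> nat set set" where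
  "graph_components U E = (\<lambda>u. {v \<in> U. (u, v) \<in> (edge_rel E)\<^sup>*}) ` U"

definition graph_connected :: "nat set \<Rightarrow> nat set set \<Rightarrow> bool" where
  "graph_connected U E \<longleftrightarrow> (\<forall>u\<in>U. \<forall>v\<in>U. (u, v) \<in> (edge_rel E)\<^sup>*)"

definition graph_cycle :: "nat set set \<Rightarrow> nat list \<Rightarrow> bool" where
  "graph_cycle E xs \<longleftrightarrow> length xs \<ge> 3 \<and> distinct xs \<and>
     (\<forall>i < length xs. {xs ! i, xs ! (Suc i mod length xs)} \<in> E)"

definition is_spanning_tree :: "nat set \<Rightarrow> nat set set \<Rightarrow> nat set set \<Rightarrow> bool" where
  "is_spanning_tree U E T \<longleftrightarrow> T \<subseteq> E \<and> graph_connected U T \<and> (\<nexists>xs. graph_cycle T xs)"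

definition is_mst :: "nat set \<Rightarrow> nat set set \<Rightarrow> (nat set \<Rightarrow> nat) \<Rightarrow> nat set set \<Rightarrow> bool" where
  "is_mst U E w T \<longleftrightarrow> is_spanning_tree U E T \<and>
     (\<forall>T'. is_spanning_tree U E T' \<longrightarrow> sum w T \<le> sum w T')"

definition is_mst_union :: "nat set \<Rightarrow> nat set set \<Rightarrow> (nat set \<Rightarrow> nat) \<Rightarrow> nat set set \<Rightarrow> bool" where
  "is_mst_union U E w T \<longleftrightarrow>
     (\<exists>f. (\<forall>K \<in> graph_components U E. is_mst K (induced_edges K E) w (f K)) \<and>
          T = \<Union> (f ` graph_components U E))"


section \<open>Configurations of the congested clique\<close>

text \<open>
  The nodes are called \<open>0, \<dots>, n - 1\<close> for reference only; a node never sees these names.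
  Port \<open>p < n - 1\<close> of node \<open>v\<close> leads to node \<open>cf_port v p\<close>.
  \<open>cf_mark v u\<close> is the specification, at node \<open>v\<close>, of whether the edge to \<open>u\<close> is in \<open>T\<close>; it
  may differ from \<open>cf_mark u v\<close>.
\<close>

record config =
  cf_size :: nat
  cf_id :: "nat \<Rightarrow> nat"
  cf_port :: "nat \<Rightarrow> nat \<Rightarrow> nat"
  cf_edges :: "nat set set"
  cf_weight :: "nat set \<Rightarrow> nat"
  cf_mark :: "nat \<Rightarrow> nat \<Rightarrow> bool"

definition wf_config :: "nat \<Rightarrow> config \<Rightarrow> bool" where
  "wf_config k C \<longleftrightarrow>
     cf_size C \<ge> 1 \<and>
     inj_on (cf_id C) {..<cf_size C} \<and>
     (\<forall>v < cf_size C. cf_id C v \<le> cf_size C ^ k) \<and>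
     (\<forall>v < cf_size C. bij_betw (cf_port C v) {..<cf_size C - 1} ({..<cf_size C} - {v})) \<and>
     cf_edges C \<subseteq> {{u, v} | u v. u < cf_size C \<and> v < cf_size C \<and> u \<noteq> v} \<and>
     (\<forall>u v. cf_mark C u v \<longrightarrow> {u, v} \<in> cf_edges C)"

text \<open>
  A local state consists of the identifier and one entry per port: \<open>None\<close> if the
  communication edge is not an input edge, and otherwise its weight and its \<open>T\<close>-mark.
\<close>

type_synonym local_state = "nat \<times> (nat \<times> bool) option list"

definition state_of :: "config \<Rightarrow> nat \<Rightarrow> local_state" where
  "state_of C v =
     (cf_id C v,
      map (\<lambda>p. let u = cf_port C v p in
                if {v, u} \<in> cf_edges C then Some (cf_weight C {v, u}, cf_mark C v u) else None)
        [0..<cf_size C - 1])"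

definition mst_family :: "nat \<Rightarrow> nat \<Rightarrow> config set" where
  "mst_family k wmax = {C. wf_config k C \<and> (\<forall>e \<in> cf_edges C. cf_weight C e \<le> wmax)}"

definition mst_predicate :: "config \<Rightarrow> bool" where
  "mst_predicate C \<longleftrightarrow>
     (\<forall>u v. {u, v} \<in> cf_edges C \<longrightarrow> cf_mark C u v = cf_mark C v u) \<and>
     is_mst_union {..<cf_size C} (cf_edges C) (cf_weight C) {{u, v} | u v. cf_mark C u v}"


section \<open>Proof-labeling schemes in the broadcast clique\<close>

type_synonym bits = "bool list"

text \<open>The last argument of \<open>pls_output\<close> lists the messages received, in the order of the ports.\<close>

record pls =
  pls_prover :: "config \<Rightarrow> nat \<Rightarrow> bits"
  pls_message :: "local_state \<Rightarrow> bits \<Rightarrow> bits"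
  pls_output :: "local_state \<Rightarrow> bits \<Rightarrow> bits list \<Rightarrow> bool"

definition sent_message :: "pls \<Rightarrow> config \<Rightarrow> (nat \<Rightarrow> bits) \<Rightarrow> nat \<Rightarrow> bits" where
  "sent_message S C l v = pls_message S (state_of C v) (l v)"

definition accepted :: "pls \<Rightarrow> config \<Rightarrow> (nat \<Rightarrow> bits) \<Rightarrow> bool" where
  "accepted S C l \<longleftrightarrow>
     (\<forall>v < cf_size C. pls_output S (state_of C v) (l v)
        (map (\<lambda>p. sent_message S C l (cf_port C v p)) [0..<cf_size C - 1]))"

definition is_pls :: "config set \<Rightarrow> (config \<Rightarrow> bool) \<Rightarrow> pls \<Rightarrow> bool" where
  "is_pls F P S \<longleftrightarrow>
     (\<forall>C \<in> F. P C \<longrightarrow> accepted S C (pls_prover S C)) \<and>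
     (\<forall>C \<in> F. \<not> P C \<longrightarrow> (\<forall>l. \<not> accepted S C l))"

definition pls_complexity :: "config set \<Rightarrow> (config \<Rightarrow> bool) \<Rightarrow> pls \<Rightarrow> nat \<Rightarrow> enat" where
  "pls_complexity F P S n =
     Sup {enat (length (sent_message S C (pls_prover S C) v)) | C v.
            C \<in> F \<and> P C \<and> cf_size C = n \<and> v < n}"

text \<open>
  The infimum over \<open>enat\<close> is a minimum if a scheme exists, and \<open>\<infinity>\<close> otherwise.
\<close>

definition verification_complexity :: "config set \<Rightarrow> (config \<Rightarrow> bool) \<Rightarrow> nat \<Rightarrow> enat" where
  "verification_complexity F P n = Inf {pls_complexity F P S n | S. is_pls F P S}"

end

theory Submission
  imports Defs "HOL-Library.FuncSet"
begin

text \<open>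
  Upper bound: every node broadcasts its identifier, the identifier of its parent in the rooted
  spanning forest \<open>T\<close>, and the weight of the edge to that parent. Then all nodes know the same forest,
  and a forest \<open>T\<close> is minimum iff the end nodes of every input edge \<open>e\<close> are joined by edges of
  \<open>T\<close> of weight at most \<open>w e\<close>, which each node can check for its own edges.

  Lower bound: if two legal configurations produce the same messages, every configuration that
  mixes their local states must be legal, too. With all weights \<open>0\<close>, two different spanning trees of
  the complete graph can be mixed to an inconsistent marking, so that different trees need different
  messages. There are \<open>(n div 2) ^ (n - n div 2)\<close> trees in which every node of the second half hangs
  on a node of the first half, but only \<open>2 ^ ((L + 1) * n)\<close> ways to send \<open>n\<close> messages of length at
  most \<open>L\<close>. For the weights, one mixes the \<open>wmax ^ (n div 4)\<close> weightings of \<open>n div 4\<close> disjoint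
  four-cycles in the same way.
\<close>

section \<open>Forests and the cycle criterion\<close>

text \<open>Minimality compares \<open>T\<close> with trees made of edges whose weights no single
  node knows. The criterion splits this comparison into one condition per input edge, about the
  weight of that edge and the weights inside the forest. One certificate per node carries the
  forest, because its edges can be charged to end nodes so that no node is charged twice. Since
  nodes see ports instead of names, different nodes know the same forest only up to bijections that
  follow their ports. The lower bounds use that a broadcast message depends on the state and label
  of its sender alone and reaches everyone, so that mixing leaves all received messages as they
  were. The mixture has to be illegal although every node sees a legal view. The defect is a mark on
  which two end nodes disagree, or a tree edge heavier than a non-tree edge of its cycle that shares
  no node with it. The latter excludes triangles, whose edges pairwise meet, and leads to
  four-cycles.\<close>

abbreviation linked :: "nat set set \<Rightarrow> nat \<Rightarrow> nat \<Rightarrow> bool" where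
  "linked F u v \<equiv> (u, v) \<in> (edge_rel F)\<^sup>*"

definition simple_graph :: "nat set \<Rightarrow> nat set set \<Rightarrow> bool" where
  "simple_graph U E \<longleftrightarrow> finite U \<and> (\<forall>e\<in>E. \<exists>u v. e = {u, v} \<and> u \<in> U \<and> v \<in> U \<and> u \<noteq> v)"

text \<open>Acyclicity in terms of reachability, which suits edge exchanges better than lists of
  vertices. A singleton in \<open>T\<close> violates it, because \<open>linked\<close> is
  reflexive.\<close>

definition all_bridges :: "nat set set \<Rightarrow> bool" where
  "all_bridges T \<longleftrightarrow> (\<forall>a b. {a, b} \<in> T \<longrightarrow> \<not> linked (T - {{a, b}}) a b)"

text \<open>The cycle property in bottleneck form: an input edge is never lighter than the heaviest
  edge on the forest path between its ends. The last clause also forces \<open>T\<close> to link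
  whatever \<open>E\<close> links.\<close>

definition msf_criterion :: "nat set set \<Rightarrow> (nat set \<Rightarrow> nat) \<Rightarrow> nat set set \<Rightarrow> bool" where
  "msf_criterion E w T \<longleftrightarrow> T \<subseteq> E \<and> all_bridges T \<and>
     (\<forall>u v. {u, v} \<in> E \<longrightarrow> linked {f \<in> T. w f \<le> w {u, v}} u v)"

lemma all_bridgesD: "all_bridges T \<Longrightarrow> {a, b} \<in> T \<Longrightarrow> \<not> linked (T - {{a, b}}) a b"
  by (simp add: all_bridges_def)

lemma msf_criterionD:
  assumes "msf_criterion E w T"
  shows "T \<subseteq> E" "all_bridges T" "{u, v} \<in> E \<Longrightarrow> linked {f \<in> T. w f \<le> w {u, v}} u v"
  using assms by (simp_all add: msf_criterion_def)

section \<open>Reachability and bridges when edges are added or removed\<close>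

lemma sym_edge_rel: "sym (edge_rel F)"
  by (auto simp: sym_def edge_rel_def insert_commute)

lemma linked_sym: "linked F u v \<Longrightarrow> linked F v u"
  using sym_rtrancl[OF sym_edge_rel] by (auto dest: symD)

lemma linked_commute: "linked F u v \<longleftrightarrow> linked F v u"
  using linked_sym by blast

lemma linked_trans: "linked F u v \<Longrightarrow> linked F v x \<Longrightarrow> linked F u x"
  by (rule rtrancl_trans)

lemma linked_mono: "linked F u v \<Longrightarrow> F \<subseteq> G \<Longrightarrow> linked G u v"
  by (rule set_mp[OF rtrancl_mono]) (auto simp: edge_rel_def)

lemma linked_edge: "{u, v} \<in> F \<Longrightarrow> linked F u v"
  by (auto simp: edge_rel_def)

lemma linked_replace:
  assumes "linked F u v" and "\<And>a b. {a, b} \<in> F \<Longrightarrow> linked G a b"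
  shows "linked G u v"
  using assms(1)
proof (induction rule: rtrancl_induct)
  case (step y z)
  then have "linked G y z" by (intro assms(2)) (simp add: edge_rel_def)
  with step.IH show ?case by (rule linked_trans)
qed simp

lemma linked_insert_cases:
  assumes "linked (insert {x, y} F) u v"
  shows "linked F u v \<or> (linked F u x \<and> linked F y v) \<or> (linked F u y \<and> linked F x v)"
proof -
  have "edge_rel (insert {x, y} F) = insert (x, y) (insert (y, x) (edge_rel F))"
    by (auto simp: edge_rel_def doubleton_eq_iff)
  with assms show ?thesis
    by (auto simp: rtrancl_insert intro: rtrancl_trans)
qed

lemma all_bridges_subset: "all_bridges T \<Longrightarrow> S \<subseteq> T \<Longrightarrow> all_bridges S"
  unfolding all_bridges_def by (meson Diff_mono linked_mono subset_iff subset_refl)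

text \<open>A bypass of an old edge \<open>{a, b}\<close> would have to run through
  \<open>{u, v}\<close>; its two remaining pieces together with \<open>{a, b}\<close> would already
  link \<open>u\<close> and \<open>v\<close> in \<open>F\<close>.\<close>

lemma all_bridges_insert:
  assumes "all_bridges F" and "\<not> linked F u v"
  shows "all_bridges (insert {u, v} F)"
  unfolding all_bridges_def
proof (intro allI impI notI)
  fix a b
  assume e: "{a, b} \<in> insert {u, v} F" and l: "linked (insert {u, v} F - {{a, b}}) a b"
  show False
  proof (cases "{a, b} = {u, v}")
    case True
    then have "linked F a b"
      using l by (auto elim: linked_mono)
    then show False
      using assms(2) True linked_commute[of u v F] by (auto simp: doubleton_eq_iff)
  next
    case False
    define G where "G = F - {{a, b}}"
    have ab: "{a, b} \<in> F" and nab: "\<not> linked G a b"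
      using e False assms(1) by (auto simp: all_bridges_def G_def)
    have "insert {u, v} F - {{a, b}} = insert {u, v} G"
      using False by (auto simp: G_def)
    with l nab have "(linked G a u \<and> linked G v b) \<or> (linked G a v \<and> linked G u b)"
      using linked_insert_cases by metis
    moreover have "linked F x y" if "linked G x y" for x y
      using that by (rule linked_mono) (auto simp: G_def)
    ultimately have "linked F u v"
      using linked_edge[OF ab] by (meson linked_sym linked_trans)
    then show False
      using assms(2) by contradiction
  qed
qed

text \<open>Stands in for following the forest path from \<open>u\<close> to \<open>v\<close> until
  it leaves \<open>G\<close>. Below, \<open>G\<close> consists of the light edges of a tree, or of
  the edges of a tree that do not cross a given cut.\<close>

lemma separating_edge:
  assumes "finite T" "all_bridges T" "G \<subseteq> T" "linked T u v" "\<not> linked G u v"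
  shows "\<exists>x y. {x, y} \<in> T - G \<and> \<not> linked (T - {{x, y}}) u v"
proof -
  text \<open>The separating edge is the last one to be added before \<open>u\<close> and \<open>v\<close> become linked.\<close>
  have "\<exists>F x y. F \<subseteq> T \<and> {x, y} \<in> T - G \<and> {x, y} \<notin> F \<and> \<not> linked F u v \<and> linked (insert {x, y} F) u v"
    if "finite H" "H \<subseteq> T - G" "linked (G \<union> H) u v" for H
    using that
  proof (induction H)
    case empty
    then show ?case using assms by simp
  next
    case (insert e H)
    show ?case
    proof (cases "linked (G \<union> H) u v")
      case True
      then show ?thesis using insert by simp
    next
      case False
      \<comment> \<open>\<open>T\<close> may contain sets that are not of the form
        \<open>{x, y}\<close>; \<open>edge_rel\<close> ignores them, so such an \<open>e\<close>
        cannot create the link.\<close>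
      have "\<exists>x y. e = {x, y}"
      proof (rule ccontr)
        assume "\<not> ?thesis"
        then have "edge_rel (G \<union> insert e H) = edge_rel (G \<union> H)"
          by (auto simp: edge_rel_def)
        then show False using insert.prems False by simp
      qed
      then show ?thesis
        using insert False assms(3) by (intro exI[of _ "G \<union> H"]) auto
    qed
  qed
  from this[of "T - G"] obtain F x y where F: "F \<subseteq> T" "{x, y} \<in> T - G" "{x, y} \<notin> F"
    "\<not> linked F u v" "linked (insert {x, y} F) u v"
    using assms by (auto simp: Un_absorb1)
  let ?R = "T - {{x, y}}"
  have up: "linked F a b \<Longrightarrow> linked ?R a b" for a b
    by (erule linked_mono) (use F in auto)
  have "(linked ?R u x \<and> linked ?R y v) \<or> (linked ?R u y \<and> linked ?R x v)"
    using linked_insert_cases[OF F(5)] F(4) up by blast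
  moreover have "\<not> linked ?R x y"
    using assms(2) F(2) by (auto simp: all_bridges_def)
  ultimately have "\<not> linked ?R u v"
    by (meson linked_sym linked_trans)
  then show ?thesis using F by blast
qed

section \<open>Bridges versus cycles given as lists of vertices\<close>

lemma linked_distinct_path:
  assumes "linked F a b"
  shows "\<exists>xs. xs \<noteq> [] \<and> hd xs = a \<and> last xs = b \<and> distinct xs \<and>
    successively (\<lambda>x y. {x, y} \<in> F) xs"
  using assms
proof (induction rule: converse_rtrancl_induct)
  case base
  show ?case by (rule exI[of _ "[b]"]) simp
next
  case (step a c)
  then obtain xs where xs: "xs \<noteq> []" "hd xs = c" "last xs = b" "distinct xs"
    "successively (\<lambda>x y. {x, y} \<in> F) xs" by blast
  show ?case
  proof (cases "a \<in> set xs")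
    case True
    then obtain ys zs where "xs = ys @ a # zs" by (meson split_list)
    then show ?thesis
      using xs by (intro exI[of _ "a # zs"]) (auto simp: successively_append_iff)
  next
    case False
    then show ?thesis
      using xs step.hyps by (intro exI[of _ "a # xs"])
        (auto simp: successively_Cons edge_rel_def)
  qed
qed

text \<open>Without its closing edge, a cycle still links the ends of that edge. Conversely, a path
  avoiding \<open>{a, b}\<close> is closed by \<open>{a, b}\<close>. It has at least three vertices:
  one would mean \<open>a = b\<close>, and two would mean that it uses
  \<open>{a, b}\<close>.\<close>

lemma all_bridges_iff_no_cycle:
  assumes "simple_graph U T"
  shows "all_bridges T \<longleftrightarrow> (\<nexists>xs. graph_cycle T xs)"
proof (intro iffI notI)
  assume "all_bridges T" "\<exists>xs. graph_cycle T xs"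
  then obtain xs where xs: "length xs \<ge> 3" "distinct xs"
    and cyc: "\<And>i. i < length xs \<Longrightarrow> {xs ! i, xs ! (Suc i mod length xs)} \<in> T"
    by (auto simp: graph_cycle_def)
  define m where "m = length xs - 1"
  have m: "length xs = Suc m" "m \<ge> 2" using xs by (auto simp: m_def)
  let ?R = "T - {{xs ! m, xs ! 0}}"
  have "linked ?R (xs ! 0) (xs ! i)" if "i \<le> m" for i
    using that
  proof (induction i)
    case (Suc i)
    have "{xs ! i, xs ! Suc i} \<in> T"
      using cyc[of i] m Suc.prems by simp
    moreover have "{xs ! i, xs ! Suc i} \<noteq> {xs ! m, xs ! 0}"
      using xs(2) m Suc.prems by (auto simp: doubleton_eq_iff nth_eq_iff_index_eq)
    ultimately have "linked ?R (xs ! i) (xs ! Suc i)"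
      by (intro linked_edge) simp
    with Suc show ?case by (meson Suc_leD linked_trans)
  qed simp
  then have "linked ?R (xs ! m) (xs ! 0)" using linked_commute by blast
  moreover have "{xs ! m, xs ! 0} \<in> T" using cyc[of m] m by simp
  ultimately show False using \<open>all_bridges T\<close> by (auto simp: all_bridges_def)
next
  assume nc: "\<nexists>xs. graph_cycle T xs"
  show "all_bridges T"
    unfolding all_bridges_def
  proof (intro allI impI notI)
    fix a b assume ab: "{a, b} \<in> T" and l: "linked (T - {{a, b}}) a b"
    obtain xs where xs: "xs \<noteq> []" "hd xs = a" "last xs = b" "distinct xs"
      and path: "successively (\<lambda>x y. {x, y} \<in> T - {{a, b}}) xs"
      using linked_distinct_path[OF l] by blast
    have "a \<noteq> b" using ab assms by (force simp: simple_graph_def doubleton_eq_iff)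
    have ends: "xs ! 0 = a" "xs ! (length xs - 1) = b"
      using xs(1-3) hd_conv_nth[of xs] last_conv_nth[of xs] by simp_all
    have step: "{xs ! i, xs ! Suc i} \<in> T - {{a, b}}" if "Suc i < length xs" for i
      using path that unfolding successively_conv_nth by blast
    have "length xs \<noteq> 0" "length xs \<noteq> 1" using xs(1) \<open>a \<noteq> b\<close> ends by auto
    moreover have "length xs \<noteq> 2" using step[of 0] ends by force
    ultimately have len: "length xs \<ge> 3" by linarith
    have "{xs ! i, xs ! (Suc i mod length xs)} \<in> T" if "i < length xs" for i
    proof (cases "Suc i < length xs")
      case True
      then show ?thesis using step[of i] by simp
    next
      case False
      then have "Suc i = length xs" using that by simp
      then have "i = length xs - 1" "Suc i mod length xs = 0" by auto
      then show ?thesis using ends ab by (simp add: insert_commute)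
    qed
    then have "graph_cycle T xs" using len xs by (simp add: graph_cycle_def)
    then show False using nc by blast
  qed
qed

section \<open>Exchange of edges between spanning trees\<close>

lemma simple_graph_subset: "simple_graph U E \<Longrightarrow> T \<subseteq> E \<Longrightarrow> simple_graph U T"
  by (auto simp: simple_graph_def)

lemma simple_graph_finite: "simple_graph U E \<Longrightarrow> finite E"
  by (rule finite_subset[of _ "Pow U"]) (auto simp: simple_graph_def)

lemma simple_graph_edgeD: "simple_graph U E \<Longrightarrow> {u, v} \<in> E \<Longrightarrow> u \<in> U \<and> v \<in> U \<and> u \<noteq> v"
  by (force simp: simple_graph_def doubleton_eq_iff)

lemma simple_graph_edgeE:
  assumes "simple_graph U E" "e \<in> E"
  obtains u v where "e = {u, v}" "u \<in> U" "v \<in> U" "u \<noteq> v"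
  using assms by (auto simp: simple_graph_def)

lemma is_spanning_tree_iff:
  assumes "simple_graph U E"
  shows "is_spanning_tree U E T \<longleftrightarrow>
    T \<subseteq> E \<and> all_bridges T \<and> (\<forall>u\<in>U. \<forall>v\<in>U. linked T u v)"
  using all_bridges_iff_no_cycle[OF simple_graph_subset[OF assms]]
  by (auto simp: is_spanning_tree_def graph_connected_def)

text \<open>\<open>u\<close> and \<open>v\<close> lie on different sides of the cut made by deleting
  \<open>f\<close>, so the new edge reconnects the ends of \<open>f\<close> and closes no
  cycle.\<close>

lemma spanning_tree_exchange:
  assumes G: "simple_graph U E" and T: "is_spanning_tree U E T"
    and f: "f \<in> T" and uv: "{u, v} \<in> E" and sep: "\<not> linked (T - {f}) u v"
  shows "is_spanning_tree U E (insert {u, v} (T - {f}))"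
proof -
  have T': "T \<subseteq> E" "all_bridges T" "\<And>x y. x \<in> U \<Longrightarrow> y \<in> U \<Longrightarrow> linked T x y"
    using T by (auto simp: is_spanning_tree_iff[OF G])
  obtain a b where ab: "f = {a, b}"
    using simple_graph_edgeE[OF G] f T'(1) by blast
  let ?G = "T - {f}" and ?N = "insert {u, v} (T - {f})"
  have up: "linked ?G x y \<Longrightarrow> linked ?N x y" for x y
    by (erule linked_mono) auto
  have "u \<in> U" "v \<in> U" using simple_graph_edgeD[OF G uv] by auto
  moreover have "insert {a, b} ?G = T" using f ab by auto
  ultimately have "linked (insert {a, b} ?G) u v" using T'(3) by simp
  then have "(linked ?G u a \<and> linked ?G b v) \<or> (linked ?G u b \<and> linked ?G a v)"
    using linked_insert_cases sep by blast
  moreover have "linked ?N u v" by (rule linked_edge) simp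
  ultimately have l: "linked ?N a b"
    using up by (meson linked_sym linked_trans)
  have "linked ?N x y" if "x \<in> U" "y \<in> U" for x y
    using T'(3)[OF that]
  proof (rule linked_replace)
    fix c d assume "{c, d} \<in> T"
    show "linked ?N c d"
    proof (cases "{c, d} = f")
      case True
      then show ?thesis using l linked_sym[OF l] ab by (auto simp: doubleton_eq_iff)
    next
      case False
      then show ?thesis using \<open>{c, d} \<in> T\<close> by (intro linked_edge) simp
    qed
  qed
  moreover have "all_bridges ?N"
    using all_bridges_insert[OF all_bridges_subset[OF T'(2)] sep] by auto
  ultimately show ?thesis using T' uv by (auto simp: is_spanning_tree_iff[OF G])
qed

text \<open>If the light edges of \<open>T\<close> fail to link \<open>u\<close> and
  \<open>v\<close>, the tree path between them contains a heavier edge, and exchanging it for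
  \<open>{u, v}\<close> gives a cheaper spanning tree.\<close>

lemma is_mst_imp_criterion:
  assumes G: "simple_graph U E" and "is_mst U E w T"
  shows "msf_criterion E w T"
proof -
  have T: "is_spanning_tree U E T" and min: "\<And>T'. is_spanning_tree U E T' \<Longrightarrow> sum w T \<le> sum w T'"
    using assms(2) by (auto simp: is_mst_def)
  have T': "T \<subseteq> E" "all_bridges T" "\<And>x y. x \<in> U \<Longrightarrow> y \<in> U \<Longrightarrow> linked T x y"
    using T by (auto simp: is_spanning_tree_iff[OF G])
  have fin: "finite T" using T'(1) simple_graph_finite[OF G] finite_subset by blast
  have "linked {f \<in> T. w f \<le> w {u, v}} u v" if uv: "{u, v} \<in> E" for u v
  proof (rule ccontr)
    assume n: "\<not> ?thesis"
    have UV: "u \<in> U" "v \<in> U" using simple_graph_edgeD[OF G uv] by auto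
    have "{f \<in> T. w f \<le> w {u, v}} \<subseteq> T" by simp
    from separating_edge[OF fin T'(2) this T'(3)[OF UV] n]
    obtain x y where e: "{x, y} \<in> T - {f \<in> T. w f \<le> w {u, v}}"
      and sep: "\<not> linked (T - {{x, y}}) u v" by blast
    have nin: "{u, v} \<notin> T - {{x, y}}" using sep linked_edge[of u v "T - {{x, y}}"] by auto
    have "sum w T \<le> sum w (insert {u, v} (T - {{x, y}}))"
      using e by (intro min spanning_tree_exchange[OF G T _ uv sep]) auto
    also have "\<dots> = w {u, v} + sum w (T - {{x, y}})" using fin nin by simp
    also have "\<dots> < w {x, y} + sum w (T - {{x, y}})" using e by (auto simp: not_le)
    also have "\<dots> = sum w T" using sum.remove[OF fin, of "{x, y}" w] e by simp
    finally show False by simp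
  qed
  then show ?thesis using T' by (simp add: msf_criterion_def)
qed

text \<open>Induction on the number of edges of \<open>T\<close> missing from the competitor
  \<open>T'\<close>. A missing edge \<open>{a, b}\<close> splits \<open>T\<close> in two, and
  \<open>T'\<close> crosses this cut in some \<open>{x, y}\<close>. The criterion joins
  \<open>x\<close> and \<open>y\<close> by edges of \<open>T\<close> of at most that weight, and
  only \<open>{a, b}\<close> crosses the cut, so \<open>{a, b}\<close> is no heavier. Exchanging the
  two brings \<open>T'\<close> closer to \<open>T\<close> without raising its weight.\<close>

lemma criterion_imp_is_mst:
  assumes G: "simple_graph U E" and conn: "\<And>u v. u \<in> U \<Longrightarrow> v \<in> U \<Longrightarrow> linked E u v"
    and crit: "msf_criterion E w T"
  shows "is_mst U E w T"
proof -
  have T: "T \<subseteq> E" "all_bridges T"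
    and c: "\<And>u v. {u, v} \<in> E \<Longrightarrow> linked {f \<in> T. w f \<le> w {u, v}} u v"
    using crit by (auto simp: msf_criterion_def)
  have fin: "finite F" if "F \<subseteq> E" for F
    using that simple_graph_finite[OF G] finite_subset by blast
  have TE: "linked T u v" if "{u, v} \<in> E" for u v
    using c[OF that] by (rule linked_mono) auto
  have "linked T u v" if "u \<in> U" "v \<in> U" for u v
    by (rule linked_replace[OF conn[OF that] TE])
  then have span: "is_spanning_tree U E T"
    using T by (simp add: is_spanning_tree_iff[OF G])
  have "sum w T \<le> sum w T'" if "is_spanning_tree U E T'" for T'
    using that
  proof (induction "card (T - T')" arbitrary: T' rule: less_induct)
    case less
    have T': "T' \<subseteq> E" "all_bridges T'" "\<And>x y. x \<in> U \<Longrightarrow> y \<in> U \<Longrightarrow> linked T' x y"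
      using less.prems by (auto simp: is_spanning_tree_iff[OF G])
    show ?case
    proof (cases "T \<subseteq> T'")
      case True
      then show ?thesis using fin[OF T'(1)] by (intro sum_mono2) auto
    next
      case False
      then obtain a b where ab: "{a, b} \<in> T" "{a, b} \<notin> T'"
        using simple_graph_edgeE[OF G] T(1) by blast
      let ?R = "T - {{a, b}}"
      have abU: "a \<in> U" "b \<in> U" and abE: "{a, b} \<in> E"
        using simple_graph_edgeD[OF G] ab T by blast+
      have nR: "\<not> linked ?R a b" using T(2) ab by (auto simp: all_bridges_def)
      \<comment> \<open>The edges of \<open>T'\<close> that stay on one side of the cut; a
        separating edge outside \<open>Q\<close> has to cross it.\<close>
      define Q where "Q = {e \<in> T'. \<forall>p q. e = {p, q} \<longrightarrow> linked ?R p q}"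
      have "linked ?R p q" if "{p, q} \<in> Q" for p q
        using that unfolding Q_def by blast
      then have "\<not> linked Q a b" using linked_replace nR by metis
      moreover have "Q \<subseteq> T'" by (simp add: Q_def)
      ultimately have "\<exists>x y. {x, y} \<in> T' - Q \<and> \<not> linked (T' - {{x, y}}) a b"
        by (intro separating_edge[OF fin[OF T'(1)] T'(2) _ T'(3)[OF abU]])
      then obtain x y where e: "{x, y} \<in> T' - Q" and sep: "\<not> linked (T' - {{x, y}}) a b"
        by (elim exE conjE)
      from e obtain p q where "{x, y} = {p, q}" "\<not> linked ?R p q"
        unfolding Q_def by blast
      then have nxy: "\<not> linked ?R x y"
        using linked_sym by (metis doubleton_eq_iff)
      then have xyT: "{x, y} \<notin> T" using ab e linked_edge[of x y ?R] by fastforce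
      have w: "w {a, b} \<le> w {x, y}"
      proof (rule ccontr)
        assume "\<not> ?thesis"
        then have "{f \<in> T. w f \<le> w {x, y}} \<subseteq> ?R" by auto
        moreover have "linked {f \<in> T. w f \<le> w {x, y}} x y" using e T'(1) by (intro c) auto
        ultimately show False using nxy linked_mono by blast
      qed
      let ?N = "insert {a, b} (T' - {{x, y}})"
      have "card (T - ?N) < card (T - T')"
        using ab xyT fin[OF T(1)] by (intro psubset_card_mono) auto
      moreover have "is_spanning_tree U E ?N"
        using spanning_tree_exchange[OF G less.prems _ abE sep] e by auto
      ultimately have "sum w T \<le> sum w ?N" by (rule less.hyps)
      also have "\<dots> = w {a, b} + sum w (T' - {{x, y}})" using fin[OF T'(1)] ab by simp
      also have "\<dots> \<le> w {x, y} + sum w (T' - {{x, y}})" using w by simp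
      also have "\<dots> = sum w T'" using sum.remove[OF fin[OF T'(1)], of "{x, y}" w] e by simp
      finally show ?thesis .
    qed
  qed
  then show ?thesis using span by (simp add: is_mst_def)
qed

section \<open>Passage between the input graph and its components\<close>

lemma simple_graph_induced:
  assumes "simple_graph U E" "K \<subseteq> U"
  shows "simple_graph K (induced_edges K E)"
  unfolding simple_graph_def
proof (intro conjI ballI)
  show "finite K" using assms finite_subset by (auto simp: simple_graph_def)
  fix e assume e: "e \<in> induced_edges K E"
  then have "e \<in> E" by (simp add: induced_edges_def)
  then obtain u v where "e = {u, v}" "u \<noteq> v"
    by (rule simple_graph_edgeE[OF assms(1)])
  then show "\<exists>u v. e = {u, v} \<and> u \<in> K \<and> v \<in> K \<and> u \<noteq> v"
    using e by (auto simp: induced_edges_def)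
qed

text \<open>Link and membership are proved together: the next edge of a walk is induced on
  \<open>K\<close> only once its far end is known to lie in \<open>K\<close>.\<close>

lemma linked_in_component:
  assumes G: "simple_graph U E" and K: "K \<in> graph_components U E" and FE: "F \<subseteq> E"
    and "linked F u v" and u: "u \<in> K"
  shows "linked (induced_edges K F) u v \<and> v \<in> K"
  using assms(4)
proof (induction rule: rtrancl_induct)
  case (step x y)
  have xy: "{x, y} \<in> F" using step.hyps by (auto simp: edge_rel_def)
  have "y \<in> U" using xy FE G by (meson simple_graph_edgeD subsetD)
  moreover obtain r where r: "K = {v \<in> U. linked E r v}"
    using K by (auto simp: graph_components_def)
  moreover have "linked E r y"
    using r step.IH linked_edge[of x y E] xy FE by (metis (lifting) linked_trans mem_Collect_eq subsetD)
  ultimately have yK: "y \<in> K" by simp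
  then have "linked (induced_edges K F) x y"
    using xy step.IH by (intro linked_edge) (auto simp: induced_edges_def)
  then show ?case using step.IH yK by (meson linked_trans)
qed (use u in simp)

lemma graph_components_disjoint:
  assumes "K \<in> graph_components U E" "K' \<in> graph_components U E" "x \<in> K" "x \<in> K'"
  shows "K = K'"
proof -
  obtain u u' where K: "K = {v \<in> U. linked E u v}" "K' = {v \<in> U. linked E u' v}"
    using assms(1,2) by (auto simp: graph_components_def)
  with assms(3,4) have "linked E u x" "linked E u' x" by auto
  then have "linked E u v \<longleftrightarrow> linked E u' v" for v
    by (meson linked_sym linked_trans)
  then show ?thesis using K by simp
qed

lemma edge_in_component:
  assumes "simple_graph U E" "{u, v} \<in> E"
  shows "\<exists>K\<in>graph_components U E. {u, v} \<in> induced_edges K E"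
proof
  show "{u, v} \<in> induced_edges {x \<in> U. linked E u x} E"
    using simple_graph_edgeD[OF assms] assms(2) linked_edge[OF assms(2)]
    by (simp add: induced_edges_def)
qed (use simple_graph_edgeD[OF assms] in \<open>simp add: graph_components_def\<close>)

text \<open>The criterion mentions no components: a walk in \<open>E\<close> never leaves its
  component, so bridges and light links can be tested there or in the whole graph alike.\<close>

lemma is_mst_union_iff_criterion:
  assumes G: "simple_graph U E"
  shows "is_mst_union U E w T \<longleftrightarrow> msf_criterion E w T"
proof -
  let ?C = "graph_components U E"
  have GK: "simple_graph K (induced_edges K E)" if "K \<in> ?C" for K
    using that by (intro simple_graph_induced[OF G]) (auto simp: graph_components_def)
  have "msf_criterion E w T" if "is_mst_union U E w T"
  proof -
    from that obtain f where f: "\<And>K. K \<in> ?C \<Longrightarrow> is_mst K (induced_edges K E) w (f K)"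
      and T: "T = \<Union> (f ` ?C)"
      by (auto simp: is_mst_union_def)
    have crit: "msf_criterion (induced_edges K E) w (f K)" if "K \<in> ?C" for K
      using is_mst_imp_criterion[OF GK[OF that] f[OF that]] .
    note sub = msf_criterionD(1)[OF crit]
    then have TE: "T \<subseteq> E" unfolding T by (fastforce simp: induced_edges_def)
    \<comment> \<open>Components are disjoint and edges nonempty, so an edge of the union that lies
      inside \<open>K\<close> comes from the tree of \<open>K\<close>.\<close>
    have TK: "induced_edges K T \<subseteq> f K" if K: "K \<in> ?C" for K
    proof
      fix e assume e: "e \<in> induced_edges K T"
      then obtain K' where K': "K' \<in> ?C" "e \<in> f K'" by (auto simp: induced_edges_def T)
      have "e \<subseteq> K'" using sub[OF K'(1)] K'(2) by (auto simp: induced_edges_def)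
      moreover have "e \<subseteq> K" "e \<in> E" using e TE by (auto simp: induced_edges_def)
      moreover from \<open>e \<in> E\<close> have "e \<noteq> {}" by (auto elim: simple_graph_edgeE[OF G])
      ultimately have "K = K'"
        using graph_components_disjoint[OF K K'(1)] by blast
      then show "e \<in> f K" using K' by simp
    qed
    have "all_bridges T"
      unfolding all_bridges_def
    proof (intro allI impI notI)
      fix a b assume ab: "{a, b} \<in> T" and l: "linked (T - {{a, b}}) a b"
      obtain K where K: "K \<in> ?C" "{a, b} \<in> f K" using ab T by auto
      have "a \<in> K" using sub[OF K(1)] K(2) by (auto simp: induced_edges_def)
      then have "linked (induced_edges K (T - {{a, b}})) a b"
        using linked_in_component[OF G K(1) _ l] TE by auto
      then have "linked (f K - {{a, b}}) a b"
        by (rule linked_mono) (use TK[OF K(1)] in \<open>auto simp: induced_edges_def\<close>)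
      then show False using all_bridgesD[OF msf_criterionD(2)[OF crit[OF K(1)]] K(2)] by simp
    qed
    moreover have "linked {g \<in> T. w g \<le> w {u, v}} u v" if uv: "{u, v} \<in> E" for u v
    proof -
      obtain K where K: "K \<in> ?C" "{u, v} \<in> induced_edges K E"
        using edge_in_component[OF G uv] by blast
      then have "linked {g \<in> f K. w g \<le> w {u, v}} u v"
        using msf_criterionD(3)[OF crit] by simp
      then show ?thesis by (rule linked_mono) (use T K in auto)
    qed
    ultimately show ?thesis using TE by (simp add: msf_criterion_def)
  qed
  moreover have "is_mst_union U E w T" if crit: "msf_criterion E w T"
  proof -
    from crit have TE: "T \<subseteq> E" and br: "all_bridges T" by (auto simp: msf_criterion_def)
    have "is_mst K (induced_edges K E) w (induced_edges K T)" if K: "K \<in> ?C" for K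
    proof (rule criterion_imp_is_mst[OF GK[OF K]])
      show "linked (induced_edges K E) u v" if "u \<in> K" "v \<in> K" for u v
      proof -
        obtain r where "K = {x \<in> U. linked E r x}"
          using K by (auto simp: graph_components_def)
        then have "linked E r u" "linked E r v" using that by auto
        then have "linked E u v" by (meson linked_sym linked_trans)
        then show ?thesis using linked_in_component[OF G K order_refl] that by blast
      qed
      have "linked {g \<in> induced_edges K T. w g \<le> w {u, v}} u v" if uv: "{u, v} \<in> induced_edges K E" for u v
      proof -
        have e: "{u, v} \<in> E" and u: "u \<in> K"
          using uv by (auto simp: induced_edges_def)
        have "linked (induced_edges K {g \<in> T. w g \<le> w {u, v}}) u v"
          using linked_in_component[OF G K _ msf_criterionD(3)[OF crit e] u] TE by auto
        then show ?thesis by (rule linked_mono) (auto simp: induced_edges_def)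
      qed
      moreover have "all_bridges (induced_edges K T)"
        by (rule all_bridges_subset[OF br]) (auto simp: induced_edges_def)
      ultimately show "msf_criterion (induced_edges K E) w (induced_edges K T)"
        using TE by (auto simp: msf_criterion_def induced_edges_def)
    qed
    moreover have "T = \<Union> ((\<lambda>K. induced_edges K T) ` ?C)"
    proof
      show "T \<subseteq> \<Union> ((\<lambda>K. induced_edges K T) ` ?C)"
      proof
        fix e assume e: "e \<in> T"
        then obtain u v where uv: "e = {u, v}" using simple_graph_edgeE[OF G] TE by blast
        then show "e \<in> \<Union> ((\<lambda>K. induced_edges K T) ` ?C)"
          using edge_in_component[OF G, of u v] e TE by (auto simp: induced_edges_def)
      qed
    qed (auto simp: induced_edges_def)
    ultimately show ?thesis
      unfolding is_mst_union_def by (intro exI[of _ "\<lambda>K. induced_edges K T"]) blast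
  qed
  ultimately show ?thesis by blast
qed

section \<open>The verification scheme\<close>

text \<open>The prescribed roots \<open>R\<close>, no two in the same tree, make the induction work.
  When an edge is added, one of its ends, \<open>c\<close>, lies in a tree of \<open>F\<close>
  without a prescribed root; so \<open>c\<close> can be made a root there and then be redirected to
  the other end \<open>d\<close>.\<close>

lemma forest_orientation:
  assumes "finite T" "simple_graph U T" "all_bridges T"
    and "\<And>r s. r \<in> R \<Longrightarrow> s \<in> R \<Longrightarrow> r \<noteq> s \<Longrightarrow> \<not> linked T r s"
  shows "\<exists>par. (\<forall>r\<in>R. par r = r) \<and> T = {{v, par v} | v. par v \<noteq> v}"
  using assms
proof (induction T arbitrary: R)
  case empty
  show ?case by (rule exI[of _ id]) simp
next
  case (insert e F)
  have eT: "e \<in> insert e F" by simp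
  obtain a b where ab: "e = {a, b}" "a \<noteq> b"
    by (rule simple_graph_edgeE[OF insert.prems(1) eT])
  have "insert e F - {{a, b}} = F" using ab insert.hyps by auto
  then have nab: "\<not> linked F a b"
    using all_bridgesD[OF insert.prems(2), of a b] ab by simp
  have up: "linked F x y \<Longrightarrow> linked (insert e F) x y" for x y
    by (erule linked_mono) auto
  have lab: "linked (insert e F) a b" using ab by (intro linked_edge) simp
  have "(\<forall>r\<in>R. \<not> linked F r a) \<or> (\<forall>r\<in>R. \<not> linked F r b)"
  proof (rule ccontr)
    assume "\<not> ?thesis"
    then obtain r s where rs: "r \<in> R" "s \<in> R" "linked F r a" "linked F s b" by blast
    have "linked (insert e F) r s"
      using linked_trans[OF linked_trans[OF up[OF rs(3)] lab] linked_sym[OF up[OF rs(4)]]] .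
    then have "r = s" using insert.prems(3) rs by blast
    then show False using rs nab linked_sym linked_trans by meson
  qed
  then obtain c d where cd: "e = {c, d}" "c \<noteq> d" "\<forall>r\<in>R. \<not> linked F r c"
    using ab by (metis insert_commute)
  have "\<exists>par. (\<forall>r\<in>insert c R. par r = r) \<and> F = {{v, par v} | v. par v \<noteq> v}"
  proof (rule insert.IH)
    show "simple_graph U F" by (rule simple_graph_subset[OF insert.prems(1)]) auto
    show "all_bridges F" by (rule all_bridges_subset[OF insert.prems(2)]) auto
    fix r s assume "r \<in> insert c R" "s \<in> insert c R" "r \<noteq> s"
    then show "\<not> linked F r s"
      using cd(3) insert.prems(3)[of r s] up[of r s] linked_commute[of r s F] by blast
  qed
  then obtain par where par: "\<forall>r\<in>insert c R. par r = r" "F = {{v, par v} | v. par v \<noteq> v}"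
    by blast
  have "c \<notin> R" using cd(3) by blast
  moreover have "insert e F = {{v, (par(c := d)) v} | v. (par(c := d)) v \<noteq> v}"
    using par cd by (auto simp: fun_upd_apply)
  ultimately show ?case using par(1) by (intro exI[of _ "par(c := d)"]) auto
qed

section \<open>Marked forests and certificates of legal configurations\<close>

definition cf_tree :: "config \<Rightarrow> nat set set" where
  "cf_tree C = {{u, v} | u v. cf_mark C u v}"

text \<open>Without legality, membership in \<open>cf_tree C\<close> says only that one of the two
  ends marks the edge.\<close>

lemma cf_tree_iff:
  assumes "mst_predicate C" "wf_config k C"
  shows "{u, v} \<in> cf_tree C \<longleftrightarrow> cf_mark C u v"
proof
  assume "{u, v} \<in> cf_tree C"
  then obtain a b where ab: "{u, v} = {a, b}" "cf_mark C a b" by (auto simp: cf_tree_def)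
  then have "{a, b} \<in> cf_edges C" using assms(2) by (auto simp: wf_config_def)
  then have "cf_mark C b a" using assms(1) ab(2) by (auto simp: mst_predicate_def)
  then show "cf_mark C u v" using ab by (metis doubleton_eq_iff)
next
  assume "cf_mark C u v"
  then show "{u, v} \<in> cf_tree C" unfolding cf_tree_def by blast
qed

lemma wf_config_simple_graph:
  assumes "wf_config k C"
  shows "simple_graph {..<cf_size C} (cf_edges C)"
  unfolding simple_graph_def
proof (intro conjI ballI)
  fix e assume "e \<in> cf_edges C"
  moreover have "cf_edges C \<subseteq> {{u, v} | u v. u < cf_size C \<and> v < cf_size C \<and> u \<noteq> v}"
    using assms by (simp add: wf_config_def)
  ultimately have "e \<in> {{u, v} | u v. u < cf_size C \<and> v < cf_size C \<and> u \<noteq> v}" by (rule rev_subsetD)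
  then show "\<exists>u v. e = {u, v} \<and> u \<in> {..<cf_size C} \<and> v \<in> {..<cf_size C} \<and> u \<noteq> v"
    by simp
qed simp

lemma mst_predicate_iff:
  assumes "wf_config k C"
  shows "mst_predicate C \<longleftrightarrow>
    (\<forall>u v. {u, v} \<in> cf_edges C \<longrightarrow> cf_mark C u v = cf_mark C v u) \<and>
    msf_criterion (cf_edges C) (cf_weight C) (cf_tree C)"
  by (simp add: mst_predicate_def is_mst_union_iff_criterion[OF wf_config_simple_graph[OF assms]]
      cf_tree_def)

definition tree_parent :: "config \<Rightarrow> nat \<Rightarrow> nat" where
  "tree_parent C = (SOME par. cf_tree C = {{v, par v} | v. par v \<noteq> v})"

text \<open>A root names itself as its parent, with the filler weight \<open>0\<close>.\<close>

definition certificate :: "config \<Rightarrow> nat \<Rightarrow> nat \<times> nat \<times> nat" where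
  "certificate C v = (let p = tree_parent C v in
     (cf_id C v, cf_id C p, if p = v then 0 else cf_weight C {v, p}))"

lemma cf_tree_eq_parent:
  assumes "wf_config k C" "mst_predicate C"
  shows "cf_tree C = {{v, tree_parent C v} | v. tree_parent C v \<noteq> v}"
proof -
  have crit: "msf_criterion (cf_edges C) (cf_weight C) (cf_tree C)"
    using assms mst_predicate_iff by blast
  have G: "simple_graph {..<cf_size C} (cf_tree C)"
    using simple_graph_subset[OF wf_config_simple_graph[OF assms(1)] msf_criterionD(1)[OF crit]] .
  have "\<exists>par. cf_tree C = {{v, par v} | v. par v \<noteq> v}"
    using forest_orientation[OF simple_graph_finite[OF G] G msf_criterionD(2)[OF crit], of "{}"]
    by auto
  then show ?thesis unfolding tree_parent_def by (rule someI_ex)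
qed

lemma cf_tree_iff_parent:
  assumes "wf_config k C" "mst_predicate C"
  shows "{u, v} \<in> cf_tree C \<longleftrightarrow> u \<noteq> v \<and> (tree_parent C u = v \<or> tree_parent C v = u)"
  unfolding cf_tree_eq_parent[OF assms] by (auto simp: doubleton_eq_iff)

lemma cf_tree_edgeD:
  assumes "wf_config k C" "{u, v} \<in> cf_tree C"
  shows "{u, v} \<in> cf_edges C" "u < cf_size C" "v < cf_size C" "u \<noteq> v"
proof -
  show "{u, v} \<in> cf_edges C"
    using assms by (auto simp: cf_tree_def wf_config_def)
  from simple_graph_edgeD[OF wf_config_simple_graph[OF assms(1)] this]
  show "u < cf_size C" "v < cf_size C" "u \<noteq> v" by auto
qed

lemma tree_parent_less:
  assumes "wf_config k C" "mst_predicate C" "v < cf_size C"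
  shows "tree_parent C v < cf_size C"
proof (cases "tree_parent C v = v")
  case False
  then have "{v, tree_parent C v} \<in> cf_tree C"
    using cf_tree_iff_parent[OF assms(1,2)] by auto
  then show ?thesis using cf_tree_edgeD[OF assms(1)] by blast
qed (use assms in simp)

section \<open>What a single node can conclude from its view\<close>

text \<open>
  \<open>C\<close> looks at node \<open>v\<close> like the legal configuration \<open>D\<close> at node \<open>\<sigma> v\<close>, if the certificates
  received by \<open>v\<close> are given by \<open>M\<close>.
\<close>

definition view_match ::
    "nat \<Rightarrow> config \<Rightarrow> (nat \<Rightarrow> nat \<times> nat \<times> nat) \<Rightarrow> nat \<Rightarrow> config \<Rightarrow> (nat \<Rightarrow> nat) \<Rightarrow> bool" where
  "view_match k C M v D \<sigma> \<longleftrightarrow> wf_config k D \<and> mst_predicate D \<and> cf_size D = cf_size C \<and>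
     bij_betw \<sigma> {..<cf_size C} {..<cf_size C} \<and> cf_id C v = cf_id D (\<sigma> v) \<and>
     (\<forall>u < cf_size C. certificate D (\<sigma> u) = M u) \<and>
     (\<forall>u < cf_size C. u \<noteq> v \<longrightarrow> ({v, u} \<in> cf_edges C \<longleftrightarrow> {\<sigma> v, \<sigma> u} \<in> cf_edges D) \<and>
        cf_mark C v u = cf_mark D (\<sigma> v) (\<sigma> u) \<and>
        ({v, u} \<in> cf_edges C \<longrightarrow> cf_weight C {v, u} = cf_weight D {\<sigma> v, \<sigma> u}))"

lemma view_matchD:
  assumes "view_match k C M v D \<sigma>"
  shows "wf_config k D" "mst_predicate D" "cf_size D = cf_size C"
    "bij_betw \<sigma> {..<cf_size C} {..<cf_size C}" "cf_id C v = cf_id D (\<sigma> v)"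
    "\<And>u. u < cf_size C \<Longrightarrow> certificate D (\<sigma> u) = M u"
    "\<And>u. u < cf_size C \<Longrightarrow> u \<noteq> v \<Longrightarrow> {v, u} \<in> cf_edges C \<longleftrightarrow> {\<sigma> v, \<sigma> u} \<in> cf_edges D"
    "\<And>u. u < cf_size C \<Longrightarrow> u \<noteq> v \<Longrightarrow> cf_mark C v u = cf_mark D (\<sigma> v) (\<sigma> u)"
    "\<And>u. u < cf_size C \<Longrightarrow> u \<noteq> v \<Longrightarrow> {v, u} \<in> cf_edges C \<Longrightarrow>
       cf_weight C {v, u} = cf_weight D {\<sigma> v, \<sigma> u}"
  using assms by (simp_all add: view_match_def)

text \<open>Adjacency as every node can read it off from the certificates. It is meant for distinct
  nodes, since a root is its own parent.\<close>

definition cert_adjacent :: "(nat \<Rightarrow> nat \<times> nat \<times> nat) \<Rightarrow> nat \<Rightarrow> nat \<Rightarrow> bool" where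
  "cert_adjacent M a b \<longleftrightarrow> fst (snd (M a)) = fst (M b) \<or> fst (snd (M b)) = fst (M a)"

definition cert_weight :: "(nat \<Rightarrow> nat \<times> nat \<times> nat) \<Rightarrow> nat \<Rightarrow> nat \<Rightarrow> nat" where
  "cert_weight M a b =
    (if fst (snd (M a)) = fst (M b) then snd (snd (M a)) else snd (snd (M b)))"

text \<open>Identifiers are distinct in \<open>D\<close>, so equal entries mean equal nodes of
  \<open>D\<close>. The right-hand sides mention neither \<open>D\<close> nor
  \<open>\<sigma>\<close>: all nodes read the same weighted forest out of \<open>M\<close>.\<close>

lemma view_match_tree:
  assumes m: "view_match k C M v D \<sigma>" and ab: "a < cf_size C" "b < cf_size C" "a \<noteq> b"
  shows "{\<sigma> a, \<sigma> b} \<in> cf_tree D \<longleftrightarrow> cert_adjacent M a b"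
    and "cert_adjacent M a b \<Longrightarrow> cf_weight D {\<sigma> a, \<sigma> b} = cert_weight M a b"
proof -
  note D = view_matchD[OF m]
  have lt: "\<sigma> u < cf_size D" if "u < cf_size C" for u
    using bij_betw_apply[OF D(4), of u] D(3) that by simp
  have ne: "\<sigma> a \<noteq> \<sigma> b" using D(4) ab by (auto simp: bij_betw_def inj_on_def)
  have inj: "inj_on (cf_id D) {..<cf_size D}" using D(1) by (simp add: wf_config_def)
  have par: "fst (snd (M c)) = fst (M d) \<longleftrightarrow> tree_parent D (\<sigma> c) = \<sigma> d"
    if "c < cf_size C" "d < cf_size C" for c d
  proof -
    have "fst (snd (M c)) = cf_id D (tree_parent D (\<sigma> c))" "fst (M d) = cf_id D (\<sigma> d)"
      by (simp_all add: D(6)[OF that(1), symmetric] D(6)[OF that(2), symmetric] certificate_def Let_def)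
    then show ?thesis
      using inj_on_eq_iff[OF inj] tree_parent_less[OF D(1,2) lt[OF that(1)]] lt[OF that(2)] by simp
  qed
  show "{\<sigma> a, \<sigma> b} \<in> cf_tree D \<longleftrightarrow> cert_adjacent M a b"
    using cf_tree_iff_parent[OF D(1,2)] ne par ab by (simp add: cert_adjacent_def)
  have wt: "snd (snd (M c)) = cf_weight D {\<sigma> c, \<sigma> d}"
    if "c < cf_size C" "tree_parent D (\<sigma> c) = \<sigma> d" "\<sigma> c \<noteq> \<sigma> d" for c d
    using that(2,3) by (simp add: D(6)[OF that(1), symmetric] certificate_def Let_def)
  show "cf_weight D {\<sigma> a, \<sigma> b} = cert_weight M a b" if "cert_adjacent M a b"
    using that wt[of a b] wt[of b a] ne par ab
    by (auto simp: cert_adjacent_def cert_weight_def insert_commute)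
qed

lemma linked_map:
  assumes "linked F u v" and "\<And>a b. {a, b} \<in> F \<Longrightarrow> {f a, f b} \<in> G"
  shows "linked G (f u) (f v)"
  using assms(1)
proof (induction rule: rtrancl_induct)
  case (step y z)
  then have "linked G (f y) (f z)" by (intro linked_edge assms(2)) (simp add: edge_rel_def)
  with step.IH show ?case by (rule linked_trans)
qed simp

text \<open>The witnesses \<open>D\<close> may vary from node to node and differ from
  \<open>C\<close> in edges that the node does not see, but all of them have the forest described by
  \<open>M\<close>. So each condition can be checked in the witness of one suitable node: a bridge
  at one of its ends, and the criterion for an input edge at one of its ends, where the weight of
  that edge is visible.\<close>

lemma legal_if_views_match:
  assumes C: "wf_config k C" and views: "\<And>v. v < cf_size C \<Longrightarrow> \<exists>D \<sigma>. view_match k C M v D \<sigma>"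
  shows "mst_predicate C"
proof -
  let ?n = "cf_size C"
  have mark: "cf_mark C v u \<longleftrightarrow> cert_adjacent M v u"
    and wt: "cert_adjacent M v u \<Longrightarrow> cf_weight C {v, u} = cert_weight M v u"
    if vu: "v < ?n" "u < ?n" "u \<noteq> v" for u v
  proof -
    obtain D \<sigma> where m: "view_match k C M v D \<sigma>" using views[OF vu(1)] by blast
    note D = view_matchD[OF m]
    have t: "cert_adjacent M v u \<longleftrightarrow> {\<sigma> v, \<sigma> u} \<in> cf_tree D"
      using view_match_tree(1)[OF m vu(1,2)] vu by simp
    then show "cf_mark C v u \<longleftrightarrow> cert_adjacent M v u"
      using D(8)[OF vu(2,3)] cf_tree_iff[OF D(2,1)] by simp
    assume adj: "cert_adjacent M v u"
    then have "{\<sigma> v, \<sigma> u} \<in> cf_edges D" using t cf_tree_edgeD(1)[OF D(1)] by blast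
    then show "cf_weight C {v, u} = cert_weight M v u"
      using D(7,9)[OF vu(2,3)] view_match_tree(2)[OF m vu(1,2) _ adj] vu by simp
  qed
  have edge: "u < ?n \<and> v < ?n \<and> u \<noteq> v" if "{u, v} \<in> cf_edges C" for u v
    using simple_graph_edgeD[OF wf_config_simple_graph[OF C] that] by simp
  have sym: "cert_adjacent M u v \<longleftrightarrow> cert_adjacent M v u" for u v
    by (auto simp: cert_adjacent_def)
  have tree: "{a, b} \<in> cf_tree C \<longleftrightarrow> a < ?n \<and> b < ?n \<and> a \<noteq> b \<and> cert_adjacent M a b" for a b
  proof
    assume t: "{a, b} \<in> cf_tree C"
    then have lt: "a < ?n" "b < ?n" "a \<noteq> b" using cf_tree_edgeD[OF C] by blast+
    from t have "cf_mark C a b \<or> cf_mark C b a" by (auto simp: cf_tree_def doubleton_eq_iff)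
    then show "a < ?n \<and> b < ?n \<and> a \<noteq> b \<and> cert_adjacent M a b"
      using mark lt sym by blast
  next
    assume "a < ?n \<and> b < ?n \<and> a \<noteq> b \<and> cert_adjacent M a b"
    then show "{a, b} \<in> cf_tree C" using mark[of a b] by (auto simp: cf_tree_def)
  qed
  have "msf_criterion (cf_edges C) (cf_weight C) (cf_tree C)"
    unfolding msf_criterion_def
  proof (intro conjI allI impI)
    show "cf_tree C \<subseteq> cf_edges C" using C by (auto simp: cf_tree_def wf_config_def)
    show "all_bridges (cf_tree C)"
      unfolding all_bridges_def
    proof (intro allI impI notI)
      fix a b assume ab: "{a, b} \<in> cf_tree C" and l: "linked (cf_tree C - {{a, b}}) a b"
      then have lt: "a < ?n" "b < ?n" "a \<noteq> b" and adj: "cert_adjacent M a b" using tree by auto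
      obtain D \<sigma> where m: "view_match k C M a D \<sigma>" using views[OF lt(1)] by blast
      note D = view_matchD[OF m]
      have inj: "inj_on \<sigma> {..<?n}" using D(4) by (simp add: bij_betw_def)
      have "linked (cf_tree D - {{\<sigma> a, \<sigma> b}}) (\<sigma> a) (\<sigma> b)"
        using l
      proof (rule linked_map)
        fix c d assume cd: "{c, d} \<in> cf_tree C - {{a, b}}"
        then have lt': "c < ?n" "d < ?n" "c \<noteq> d" and "cert_adjacent M c d" using tree by auto
        then have "{\<sigma> c, \<sigma> d} \<in> cf_tree D" using view_match_tree(1)[OF m] by blast
        moreover have "{\<sigma> c, \<sigma> d} \<noteq> {\<sigma> a, \<sigma> b}"
          using cd lt lt' inj_on_eq_iff[OF inj] by (auto simp: doubleton_eq_iff)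
        ultimately show "{\<sigma> c, \<sigma> d} \<in> cf_tree D - {{\<sigma> a, \<sigma> b}}" by simp
      qed
      moreover have "{\<sigma> a, \<sigma> b} \<in> cf_tree D" using view_match_tree(1)[OF m lt] adj by blast
      moreover have "all_bridges (cf_tree D)"
        using D(1,2) mst_predicate_iff msf_criterionD(2) by blast
      ultimately show False using all_bridgesD by blast
    qed
    fix a b assume ab: "{a, b} \<in> cf_edges C"
    then have lt: "a < ?n" "b < ?n" "b \<noteq> a" using edge by blast+
    obtain D \<sigma> where m: "view_match k C M a D \<sigma>" using views[OF lt(1)] by blast
    note D = view_matchD[OF m]
    \<comment> \<open>The inverse of \<open>\<sigma>\<close> carries the light path found in
      \<open>D\<close> back to \<open>C\<close>; its edges keep their weights, since both weights
      are given by the certificates.\<close>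
    let ?\<tau> = "inv_into {..<?n} \<sigma>"
    have \<tau>: "?\<tau> (\<sigma> u) = u" if "u < ?n" for u
      using bij_betw_inv_into_left[OF D(4)] that by simp
    have \<sigma>: "\<exists>c<?n. c' = \<sigma> c" if "c' < ?n" for c'
      using D(4) that by (auto simp: bij_betw_def image_iff set_eq_iff)
    have w: "cf_weight C {a, b} = cf_weight D {\<sigma> a, \<sigma> b}" and e: "{\<sigma> a, \<sigma> b} \<in> cf_edges D"
      using D(7,9)[OF lt(2,3)] ab by auto
    have "msf_criterion (cf_edges D) (cf_weight D) (cf_tree D)"
      using D(1,2) mst_predicate_iff by blast
    from msf_criterionD(3)[OF this e]
    have "linked {f \<in> cf_tree C. cf_weight C f \<le> cf_weight C {a, b}} (?\<tau> (\<sigma> a)) (?\<tau> (\<sigma> b))"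
    proof (rule linked_map)
      fix c' d' assume t: "{c', d'} \<in> {f \<in> cf_tree D. cf_weight D f \<le> cf_weight D {\<sigma> a, \<sigma> b}}"
      then have "c' < ?n" "d' < ?n" "c' \<noteq> d'" using cf_tree_edgeD[OF D(1)] D(3) by auto
      then obtain c d where cd: "c < ?n" "d < ?n" "c' = \<sigma> c" "d' = \<sigma> d" "c \<noteq> d"
        using \<sigma> by metis
      have adj: "cert_adjacent M c d" using view_match_tree(1)[OF m cd(1,2,5)] t cd by simp
      have "cf_weight C {c, d} = cf_weight D {\<sigma> c, \<sigma> d}"
        using view_match_tree(2)[OF m cd(1,2,5) adj] wt[OF cd(1,2) _ adj] cd(5) by simp
      then have "{c, d} \<in> {f \<in> cf_tree C. cf_weight C f \<le> cf_weight C {a, b}}"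
        using t tree adj cd w by simp
      then show "{?\<tau> c', ?\<tau> d'} \<in> {f \<in> cf_tree C. cf_weight C f \<le> cf_weight C {a, b}}"
        using \<tau> cd by simp
    qed
    then show "linked {f \<in> cf_tree C. cf_weight C f \<le> cf_weight C {a, b}} a b"
      using \<tau> lt by simp
  qed
  moreover have "cf_mark C u v = cf_mark C v u" if "{u, v} \<in> cf_edges C" for u v
    using edge[OF that] mark sym by metis
  ultimately show ?thesis using mst_predicate_iff[OF C] by blast
qed

section \<open>Encoding of certificates by bit strings\<close>

definition certificate_space :: "nat \<Rightarrow> nat \<Rightarrow> nat \<Rightarrow> (nat \<times> nat \<times> nat) set" where
  "certificate_space k wmax n = {..n ^ k} \<times> {..n ^ k} \<times> {..wmax}"

definition certificate_bits :: "nat \<Rightarrow> nat \<Rightarrow> nat \<Rightarrow> nat" where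
  "certificate_bits k wmax n = nat \<lceil>log 2 (real (card (certificate_space k wmax n)))\<rceil>"

text \<open>A fixed-length code, which exists by counting. It depends on \<open>n\<close>, but every
  node knows \<open>n\<close> from its number of ports.\<close>

definition encode :: "nat \<Rightarrow> nat \<Rightarrow> nat \<Rightarrow> nat \<times> nat \<times> nat \<Rightarrow> bits" where
  "encode k wmax n = (SOME f. inj_on f (certificate_space k wmax n) \<and>
     (\<forall>x \<in> certificate_space k wmax n. length (f x) = certificate_bits k wmax n))"

lemma card_certificate_space:
  "card (certificate_space k wmax n) = (n ^ k + 1) * ((n ^ k + 1) * (wmax + 1))"
  by (simp add: certificate_space_def card_cartesian_product)

lemma card_certificate_space_pos: "1 \<le> real (card (certificate_space k wmax n))"
proof -
  have "1 \<le> card (certificate_space k wmax n)" by (simp add: card_certificate_space)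
  then show ?thesis by simp
qed

lemma
  shows encode_inj: "inj_on (encode k wmax n) (certificate_space k wmax n)"
    and encode_length: "x \<in> certificate_space k wmax n \<Longrightarrow>
      length (encode k wmax n x) = certificate_bits k wmax n"
proof -
  let ?A = "certificate_space k wmax n" and ?b = "certificate_bits k wmax n"
  let ?B = "{xs :: bits. set xs \<subseteq> UNIV \<and> length xs = ?b}"
  have pos: "0 < real (card ?A)" using card_certificate_space_pos[of k wmax n] by linarith
  have "log 2 (real (card ?A)) \<le> real ?b"
    unfolding certificate_bits_def by (rule real_nat_ceiling_ge)
  then have "real (card ?A) \<le> 2 powr real ?b"
    using pos by (simp add: log_le_iff)
  then have "real (card ?A) \<le> real (2 ^ ?b)" by (simp add: powr_realpow)
  then have "card ?A \<le> 2 ^ ?b" by (simp only: of_nat_le_iff)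
  also have "2 ^ ?b = card ?B"
    by (subst card_lists_length_eq) simp_all
  finally have "card ?A \<le> card ?B" .
  moreover have "finite ?A" by (simp add: certificate_space_def)
  moreover have "finite ?B" by (rule finite_lists_length_eq) simp
  ultimately have "\<exists>f. inj_on f ?A \<and> f ` ?A \<subseteq> ?B" by (simp only: inj_on_iff_card_le)
  then obtain f where "inj_on f ?A" "f ` ?A \<subseteq> ?B" by (elim exE conjE)
  then have "\<exists>f :: _ \<Rightarrow> bits. inj_on f ?A \<and> (\<forall>x\<in>?A. length (f x) = ?b)" by (intro exI[of _ f]) auto
  then have "inj_on (encode k wmax n) ?A \<and> (\<forall>x\<in>?A. length (encode k wmax n x) = ?b)"
    unfolding encode_def by (rule someI_ex)
  then show "inj_on (encode k wmax n) ?A" "x \<in> ?A \<Longrightarrow> length (encode k wmax n x) = ?b"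
    by blast+
qed

lemma certificate_in_space:
  assumes "C \<in> mst_family k wmax" "mst_predicate C" "v < cf_size C"
  shows "certificate C v \<in> certificate_space k wmax (cf_size C)"
proof -
  have C: "wf_config k C" and w: "\<And>e. e \<in> cf_edges C \<Longrightarrow> cf_weight C e \<le> wmax"
    using assms(1) by (auto simp: mst_family_def)
  have id: "cf_id C u \<le> cf_size C ^ k" if "u < cf_size C" for u
    using C that by (simp add: wf_config_def)
  have "tree_parent C v \<noteq> v \<Longrightarrow> {v, tree_parent C v} \<in> cf_edges C"
    using cf_tree_iff_parent[OF C assms(2)] by (intro cf_tree_edgeD(1)[OF C]) auto
  then show ?thesis
    using id assms(3) tree_parent_less[OF C assms(2,3)] w
    by (auto simp: certificate_def certificate_space_def Let_def)
qed

section \<open>The scheme and its soundness\<close>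

definition mst_label :: "nat \<Rightarrow> nat \<Rightarrow> config \<Rightarrow> nat \<Rightarrow> bits" where
  "mst_label k wmax C v = encode k wmax (cf_size C) (certificate C v)"

text \<open>
  The verifier asks whether the view of the node occurs in some legal configuration. Completeness is
  then immediate. The scheme is sound because the legal configurations found by different nodes carry
  the same certificates, and hence have the same marked forest.
\<close>

definition mst_scheme :: "nat \<Rightarrow> nat \<Rightarrow> pls" where
  "mst_scheme k wmax =
     \<lparr>pls_prover = mst_label k wmax,
      pls_message = (\<lambda>s l. l),
      pls_output = (\<lambda>s l ms. \<exists>D x. D \<in> mst_family k wmax \<and> mst_predicate D \<and> x < cf_size D \<and>
        state_of D x = s \<and> mst_label k wmax D x = l \<and>
        map (\<lambda>p. mst_label k wmax D (cf_port D x p)) [0..<cf_size D - 1] = ms)\<rparr>"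

text \<open>The node behind port \<open>p\<close> of \<open>v\<close> goes to the node behind port
  \<open>p\<close> of \<open>x\<close>. This turns entrywise equality of lists indexed by ports into
  a statement about a bijection of nodes.\<close>

lemma port_isomorphism:
  assumes C: "wf_config k C" "v < cf_size C" and D: "wf_config k D" "x < cf_size D"
    and size: "cf_size D = cf_size C"
  obtains \<sigma> where "bij_betw \<sigma> {..<cf_size C} {..<cf_size C}" "\<sigma> v = x"
    "\<And>p. p < cf_size C - 1 \<Longrightarrow> \<sigma> (cf_port C v p) = cf_port D x p"
proof -
  let ?n = "cf_size C" and ?P = "{..<cf_size C - 1}"
  have bC: "bij_betw (cf_port C v) ?P ({..<?n} - {v})" using C by (simp add: wf_config_def)
  have bD: "bij_betw (cf_port D x) ?P ({..<?n} - {x})" using D size by (simp add: wf_config_def)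
  define g where "g = cf_port D x \<circ> inv_into ?P (cf_port C v)"
  define \<sigma> where "\<sigma> = (\<lambda>u. if u = v then x else g u)"
  have "bij_betw g ({..<?n} - {v}) ({..<?n} - {x})"
    unfolding g_def by (rule bij_betw_trans[OF bij_betw_inv_into[OF bC] bD])
  then have "bij_betw \<sigma> ({..<?n} - {v}) ({..<?n} - {x})"
    by (rule bij_betw_cong[THEN iffD1, rotated]) (simp add: \<sigma>_def)
  then have "bij_betw \<sigma> (insert v ({..<?n} - {v})) (insert (\<sigma> v) ({..<?n} - {x}))"
    by (intro notIn_Un_bij_betw[of v _ \<sigma>, simplified]) (auto simp: \<sigma>_def)
  moreover have "insert v ({..<?n} - {v}) = {..<?n}" "insert (\<sigma> v) ({..<?n} - {x}) = {..<?n}"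
    using C D size by (auto simp: \<sigma>_def)
  ultimately have "bij_betw \<sigma> {..<?n} {..<?n}" by simp
  moreover have "\<sigma> (cf_port C v p) = cf_port D x p" if "p < ?n - 1" for p
    using bij_betw_apply[OF bC, of p] bij_betw_inv_into_left[OF bC, of p] that
    by (simp add: \<sigma>_def g_def)
  ultimately show thesis by (intro that[of \<sigma>]) (auto simp: \<sigma>_def)
qed

lemma view_match_of_state:
  assumes C: "wf_config k C" "v < cf_size C"
    and D: "wf_config k D" "mst_predicate D" "x < cf_size D"
    and state: "state_of D x = state_of C v"
    and M: "certificate D x = M v"
      "\<And>p. p < cf_size C - 1 \<Longrightarrow> certificate D (cf_port D x p) = M (cf_port C v p)"
  shows "\<exists>\<sigma>. view_match k C M v D \<sigma>"
proof -
  let ?n = "cf_size C"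
  let ?f = "\<lambda>C v p. let u = cf_port C v p in
    if {v, u} \<in> cf_edges C then Some (cf_weight C {v, u}, cf_mark C v u) else None"
  have id: "cf_id D x = cf_id C v"
    and maps: "map (?f D x) [0..<cf_size D - 1] = map (?f C v) [0..<?n - 1]"
    using state by (simp_all add: state_of_def)
  from maps have "length (map (?f D x) [0..<cf_size D - 1]) = length (map (?f C v) [0..<?n - 1])"
    by (rule arg_cong)
  then have size: "cf_size D = ?n" using C D by simp
  have entry: "?f D x p = ?f C v p" if "p < ?n - 1" for p
    using arg_cong[OF maps, of "\<lambda>xs. xs ! p"] that size by simp
  obtain \<sigma> where \<sigma>: "bij_betw \<sigma> {..<?n} {..<?n}" "\<sigma> v = x"
    "\<And>p. p < ?n - 1 \<Longrightarrow> \<sigma> (cf_port C v p) = cf_port D x p"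
    by (rule port_isomorphism[OF C D(1,3) size]) blast
  have port: "\<exists>p < ?n - 1. u = cf_port C v p" if "u < ?n" "u \<noteq> v" for u
  proof -
    have "bij_betw (cf_port C v) {..<?n - 1} ({..<?n} - {v})" using C by (simp add: wf_config_def)
    then have "u \<in> cf_port C v ` {..<?n - 1}" using that by (simp add: bij_betw_def)
    then show ?thesis by auto
  qed
  have "certificate D (\<sigma> u) = M u" if "u < ?n" for u
    using M \<sigma>(2,3) port[OF that] by (cases "u = v") auto
  moreover have "({v, u} \<in> cf_edges C \<longleftrightarrow> {\<sigma> v, \<sigma> u} \<in> cf_edges D) \<and>
      cf_mark C v u = cf_mark D (\<sigma> v) (\<sigma> u) \<and>
      ({v, u} \<in> cf_edges C \<longrightarrow> cf_weight C {v, u} = cf_weight D {\<sigma> v, \<sigma> u})"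
    if u: "u < ?n" "u \<noteq> v" for u
  proof -
    obtain p where p: "p < ?n - 1" "u = cf_port C v p" using port[OF u] by blast
    have "(if {\<sigma> v, \<sigma> u} \<in> cf_edges D then Some (cf_weight D {\<sigma> v, \<sigma> u}, cf_mark D (\<sigma> v) (\<sigma> u)) else None)
        = (if {v, u} \<in> cf_edges C then Some (cf_weight C {v, u}, cf_mark C v u) else None)"
      using entry[OF p(1)] unfolding Let_def p(2) \<sigma>(2) \<sigma>(3)[OF p(1)] .
    \<comment> \<open>An entry \<open>None\<close> hides the mark; as marks occur on input edges
      only, both marks are false then.\<close>
    moreover have "cf_mark C v u \<Longrightarrow> {v, u} \<in> cf_edges C"
      using C(1) by (simp add: wf_config_def)
    moreover have "cf_mark D (\<sigma> v) (\<sigma> u) \<Longrightarrow> {\<sigma> v, \<sigma> u} \<in> cf_edges D"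
      using D(1) by (simp add: wf_config_def)
    ultimately show ?thesis by (auto split: if_splits)
  qed
  ultimately show ?thesis
    using D(1,2) size \<sigma>(1,2) id by (intro exI[of _ \<sigma>]) (simp add: view_match_def)
qed

lemma mst_scheme_sound:
  assumes C: "C \<in> mst_family k wmax" and acc: "accepted (mst_scheme k wmax) C l"
  shows "mst_predicate C"
proof -
  let ?n = "cf_size C"
  have wf: "wf_config k C" using C by (simp add: mst_family_def)
  have "\<exists>D x. D \<in> mst_family k wmax \<and> mst_predicate D \<and> x < cf_size D \<and>
      state_of D x = state_of C v \<and> mst_label k wmax D x = l v \<and> cf_size D = ?n \<and>
      (\<forall>p < ?n - 1. mst_label k wmax D (cf_port D x p) = l (cf_port C v p))"
    if v: "v < ?n" for v
  proof -
    obtain D x where D: "D \<in> mst_family k wmax" "mst_predicate D" "x < cf_size D"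
      "state_of D x = state_of C v" "mst_label k wmax D x = l v"
      "map (\<lambda>p. mst_label k wmax D (cf_port D x p)) [0..<cf_size D - 1] =
        map (\<lambda>p. l (cf_port C v p)) [0..<?n - 1]"
      using acc v by (auto simp: accepted_def mst_scheme_def sent_message_def)
    from D(6) have "length (map (\<lambda>p. mst_label k wmax D (cf_port D x p)) [0..<cf_size D - 1]) =
        length (map (\<lambda>p. l (cf_port C v p)) [0..<?n - 1])"
      by (rule arg_cong)
    \<comment> \<open>The number of messages gives \<open>n - 1\<close>; both sizes are positive, so
      truncated subtraction loses nothing.\<close>
    then have size: "cf_size D = ?n" using v D(3) by simp
    have "mst_label k wmax D (cf_port D x p) = l (cf_port C v p)" if "p < ?n - 1" for p
      using arg_cong[OF D(6), of "\<lambda>xs. xs ! p"] that size by simp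
    then show ?thesis using D size by blast
  qed
  then obtain D x where D: "\<And>v. v < ?n \<Longrightarrow> D v \<in> mst_family k wmax \<and> mst_predicate (D v) \<and>
      x v < cf_size (D v) \<and> state_of (D v) (x v) = state_of C v \<and>
      mst_label k wmax (D v) (x v) = l v \<and> cf_size (D v) = ?n \<and>
      (\<forall>p < ?n - 1. mst_label k wmax (D v) (cf_port (D v) (x v) p) = l (cf_port C v p))"
    by metis
  \<comment> \<open>The certificate that the witness of \<open>v\<close> gives to \<open>v\<close>
    itself. As the code is injective, the witnesses of the other nodes give it to \<open>v\<close>,
    too.\<close>
  define M where "M v = certificate (D v) (x v)" for v
  have M: "M v \<in> certificate_space k wmax ?n" "l v = encode k wmax ?n (M v)" if "v < ?n" for v
    using certificate_in_space[of "D v" k wmax "x v"] D[OF that]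
    by (auto simp: M_def mst_label_def)
  have "\<exists>E \<sigma>. view_match k C M v E \<sigma>" if v: "v < ?n" for v
  proof -
    have wfD: "wf_config k (D v)" using D[OF v] by (simp add: mst_family_def)
    have "certificate (D v) (cf_port (D v) (x v) p) = M (cf_port C v p)" if p: "p < ?n - 1" for p
    proof -
      have "bij_betw (cf_port C v) {..<?n - 1} ({..<?n} - {v})"
        using wf v by (simp add: wf_config_def)
      then have u: "cf_port C v p < ?n" using p bij_betw_apply by fastforce
      have "bij_betw (cf_port (D v) (x v)) {..<?n - 1} ({..<?n} - {x v})"
        using wfD D[OF v] by (simp add: wf_config_def)
      then have y: "cf_port (D v) (x v) p < cf_size (D v)"
        using p D[OF v] bij_betw_apply by fastforce
      have "certificate (D v) (cf_port (D v) (x v) p) \<in> certificate_space k wmax ?n"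
        using certificate_in_space[of "D v" k wmax, OF _ _ y] D[OF v] by simp
      moreover have "encode k wmax ?n (certificate (D v) (cf_port (D v) (x v) p)) =
          encode k wmax ?n (M (cf_port C v p))"
      proof -
        have "mst_label k wmax (D v) (cf_port (D v) (x v) p) = l (cf_port C v p)" "cf_size (D v) = ?n"
          using D[OF v] p by blast+
        then show ?thesis using M(2)[OF u] by (simp add: mst_label_def)
      qed
      ultimately show ?thesis using encode_inj M(1)[OF u] by (metis inj_onD)
    qed
    moreover have "mst_predicate (D v)" "x v < cf_size (D v)" "state_of (D v) (x v) = state_of C v"
      using D[OF v] by blast+
    ultimately have "\<exists>\<sigma>. view_match k C M v (D v) \<sigma>"
      by (intro view_match_of_state[OF wf v wfD]) (simp_all add: M_def)
    then show ?thesis by blast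
  qed
  then show ?thesis by (rule legal_if_views_match[OF wf])
qed

lemma mst_scheme_is_pls: "is_pls (mst_family k wmax) mst_predicate (mst_scheme k wmax)"
  unfolding is_pls_def
proof (intro conjI ballI impI allI notI)
  fix C assume "C \<in> mst_family k wmax" "mst_predicate C"
  then show "accepted (mst_scheme k wmax) C (pls_prover (mst_scheme k wmax) C)"
    unfolding accepted_def mst_scheme_def sent_message_def pls.simps by blast
next
  fix C l assume "C \<in> mst_family k wmax" "\<not> mst_predicate C" "accepted (mst_scheme k wmax) C l"
  then show False using mst_scheme_sound by blast
qed

section \<open>Length of the messages\<close>

lemma verification_complexity_upper:
  "verification_complexity (mst_family k wmax) mst_predicate n \<le> enat (certificate_bits k wmax n)"
proof -
  have "pls_complexity (mst_family k wmax) mst_predicate (mst_scheme k wmax) n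
      \<le> enat (certificate_bits k wmax n)"
    unfolding pls_complexity_def
  proof (rule Sup_least, elim CollectE exE conjE)
    fix y C v
    assume y: "y = enat (length (sent_message (mst_scheme k wmax) C (pls_prover (mst_scheme k wmax) C) v))"
      and C: "C \<in> mst_family k wmax" "mst_predicate C" "cf_size C = n" "v < n"
    then have "certificate C v \<in> certificate_space k wmax n"
      using certificate_in_space by blast
    then show "y \<le> enat (certificate_bits k wmax n)"
      using encode_length C(3) by (simp add: y sent_message_def mst_scheme_def mst_label_def)
  qed
  then show ?thesis
    unfolding verification_complexity_def
    by (intro Inf_lower2[OF _ ]) (use mst_scheme_is_pls in blast)
qed

text \<open>In the number of certificates, each of the three factors \<open>y + 1\<close> is at most
  \<open>2 * y\<close>, which costs \<open>3\<close> bits beyond two identifiers and a weight;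
  rounding up costs one more. As \<open>log 2 n\<close> is at least \<open>1\<close>, its
  coefficient absorbs this \<open>4\<close>.\<close>

lemma certificate_bits_le:
  assumes "n \<ge> 2" "wmax \<ge> 1"
  shows "real (certificate_bits k wmax n) \<le> (2 * real k + 4) * (log 2 (real n) + log 2 (real wmax))"
proof -
  let ?M = "real (card (certificate_space k wmax n))"
  have nk: "real n ^ k \<ge> 1" using assms by simp
  have ge: "?M \<ge> 1" by (rule card_certificate_space_pos)
  have "?M = (real n ^ k + 1) * ((real n ^ k + 1) * (real wmax + 1))"
    by (simp only: card_certificate_space of_nat_mult of_nat_add of_nat_power of_nat_1)
  also have "\<dots> \<le> (2 * real n ^ k) * ((2 * real n ^ k) * (2 * real wmax))"
    using nk assms by (intro mult_mono) auto
  finally have "log 2 ?M \<le> log 2 ((2 * real n ^ k) * ((2 * real n ^ k) * (2 * real wmax)))"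
    using ge by simp
  also have "\<dots> = 3 + 2 * real k * log 2 (real n) + log 2 (real wmax)"
    using assms log_pow_cancel[of 2 3] by (simp add: log_mult log_nat_power)
  finally have "log 2 ?M \<le> 3 + 2 * real k * log 2 (real n) + log 2 (real wmax)" .
  moreover have "0 \<le> log 2 ?M" using ge by simp
  ultimately have "real (certificate_bits k wmax n) \<le> 4 + 2 * real k * log 2 (real n) + log 2 (real wmax)"
    unfolding certificate_bits_def by linarith
  also have "\<dots> \<le> (2 * real k + 4) * log 2 (real n) + (2 * real k + 4) * log 2 (real wmax)"
  proof -
    have "log 2 (real n) \<ge> 1" using assms by (simp add: le_log_iff)
    moreover have "log 2 (real wmax) \<ge> 0" using assms by simp
    then have "log 2 (real wmax) \<le> (2 * real k + 4) * log 2 (real wmax)"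
      using mult_right_mono[of 1 "2 * real k + 4" "log 2 (real wmax)"] by simp
    ultimately show ?thesis by (simp add: algebra_simps)
  qed
  finally show ?thesis by (simp add: algebra_simps)
qed

section \<open>Lower bounds\<close>

lemma card_bits_le: "card {xs :: bits. length xs \<le> L} \<le> 2 ^ (L + 1)"
proof -
  have "card {xs :: bits. set xs \<subseteq> UNIV \<and> length xs \<le> L} = (\<Sum>i\<le>L. 2 ^ i)"
    by (subst card_lists_length_le) simp_all
  also have "\<dots> \<le> 2 ^ (L + 1)" by (induction L) auto
  finally show ?thesis by simp
qed

lemma finite_bits_le: "finite {xs :: bits. length xs \<le> L}"
  using finite_lists_length_le[of "UNIV :: bool set" L] by simp

lemma message_counting:
  assumes legal: "\<And>x. x \<in> X \<Longrightarrow> conf x \<in> F \<and> P (conf x) \<and> cf_size (conf x) = n"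
    and L: "pls_complexity F P S n \<le> enat L"
    and inj: "\<And>x y. x \<in> X \<Longrightarrow> y \<in> X \<Longrightarrow>
      (\<And>v. v < n \<Longrightarrow> sent_message S (conf x) (pls_prover S (conf x)) v =
        sent_message S (conf y) (pls_prover S (conf y)) v) \<Longrightarrow> x = y"
  shows "card X \<le> 2 ^ ((L + 1) * n)"
proof -
  let ?msg = "\<lambda>x v. sent_message S (conf x) (pls_prover S (conf x)) v"
  let ?B = "{xs :: bits. length xs \<le> L}"
  let ?g = "\<lambda>x. restrict (?msg x) {..<n}"
  have "length (?msg x v) \<le> L" if "x \<in> X" "v < n" for x v
  proof -
    have "enat (length (?msg x v)) \<le> pls_complexity F P S n"
      unfolding pls_complexity_def using legal[OF that(1)] that(2) by (intro Sup_upper) blast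
    then have "enat (length (?msg x v)) \<le> enat L" using L by (rule order_trans)
    then show ?thesis by simp
  qed
  then have "?g ` X \<subseteq> {..<n} \<rightarrow>\<^sub>E ?B"
    by (intro image_subsetI) (simp add: restrict_PiE_iff)
  moreover have inj_g: "inj_on ?g X"
  proof (rule inj_onI)
    fix x y assume xy: "x \<in> X" "y \<in> X" "?g x = ?g y"
    have "?msg x v = ?msg y v" if "v < n" for v
      using fun_cong[OF xy(3), of v] that by simp
    then show "x = y" by (rule inj[OF xy(1,2)])
  qed
  moreover have "finite ({..<n} \<rightarrow>\<^sub>E ?B)" by (intro finite_PiE finite_bits_le) simp
  ultimately have "card X \<le> card ({..<n} \<rightarrow>\<^sub>E ?B)" by (intro card_inj_on_le[OF inj_g])
  also have "\<dots> = card ?B ^ n" by (simp add: card_PiE)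
  also have "\<dots> \<le> (2 ^ (L + 1)) ^ n" by (intro power_mono card_bits_le) simp
  finally show ?thesis by (simp only: power_mult)
qed

text \<open>Label each node of \<open>H\<close> as in the configuration from which its state comes.
  It then sends what it sends in both configurations, on all ports alike, so every node has a view
  that it accepts in \<open>C\<close> or in \<open>C'\<close>. Soundness forces \<open>H\<close> to
  be legal.\<close>

lemma hybrid_legal:
  assumes S: "is_pls F P S" and C: "C \<in> F" "P C" "C' \<in> F" "P C'" "H \<in> F"
    and size: "cf_size C = cf_size H" "cf_size C' = cf_size H"
    and port: "cf_port C = cf_port H" "cf_port C' = cf_port H"
    and port_less: "\<And>v p. v < cf_size H \<Longrightarrow> p < cf_size H - 1 \<Longrightarrow> cf_port H v p < cf_size H"
    and msg: "\<And>v. v < cf_size H \<Longrightarrow>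
      sent_message S C (pls_prover S C) v = sent_message S C' (pls_prover S C') v"
    and state: "\<And>v. v < cf_size H \<Longrightarrow> v \<in> A \<Longrightarrow> state_of H v = state_of C' v"
      "\<And>v. v < cf_size H \<Longrightarrow> v \<notin> A \<Longrightarrow> state_of H v = state_of C v"
  shows "P H"
proof (rule ccontr)
  assume "\<not> P H"
  define l where "l v = (if v \<in> A then pls_prover S C' v else pls_prover S C v)" for v
  have sent: "sent_message S H l v = sent_message S C (pls_prover S C) v"
    "sent_message S H l v = sent_message S C' (pls_prover S C') v" if "v < cf_size H" for v
    using state[OF that] msg[OF that] by (auto simp: sent_message_def l_def)
  have acc: "accepted S C (pls_prover S C)" "accepted S C' (pls_prover S C')"
    using S C by (auto simp: is_pls_def)
  have "pls_output S (state_of H v) (l v)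
      (map (\<lambda>p. sent_message S H l (cf_port H v p)) [0..<cf_size H - 1])" if v: "v < cf_size H" for v
  proof (cases "v \<in> A")
    case True
    have eq: "map (\<lambda>p. sent_message S H l (cf_port H v p)) [0..<cf_size H - 1] =
        map (\<lambda>p. sent_message S C' (pls_prover S C') (cf_port C' v p)) [0..<cf_size C' - 1]"
      using sent(2) port_less[OF v] size port by simp
    have "pls_output S (state_of C' v) (pls_prover S C' v)
        (map (\<lambda>p. sent_message S C' (pls_prover S C') (cf_port C' v p)) [0..<cf_size C' - 1])"
      using acc(2) v size by (simp only: accepted_def)
    then show ?thesis
      unfolding eq state(1)[OF v True] using True by (simp add: l_def)
  next
    case False
    have eq: "map (\<lambda>p. sent_message S H l (cf_port H v p)) [0..<cf_size H - 1] =
        map (\<lambda>p. sent_message S C (pls_prover S C) (cf_port C v p)) [0..<cf_size C - 1]"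
      using sent(1) port_less[OF v] size port by simp
    have "pls_output S (state_of C v) (pls_prover S C v)
        (map (\<lambda>p. sent_message S C (pls_prover S C) (cf_port C v p)) [0..<cf_size C - 1])"
      using acc(1) v size by (simp only: accepted_def)
    then show ?thesis
      unfolding eq state(2)[OF v False] using False by (simp add: l_def)
  qed
  then have "accepted S H l" by (simp add: accepted_def)
  then show False using S C(5) \<open>\<not> P H\<close> by (auto simp: is_pls_def)
qed

section \<open>Configurations with common identifiers and ports\<close>

definition standard_config ::
    "nat \<Rightarrow> nat set set \<Rightarrow> (nat set \<Rightarrow> nat) \<Rightarrow> (nat \<Rightarrow> nat \<Rightarrow> bool) \<Rightarrow> config" where
  "standard_config n E w mark =
     \<lparr>cf_size = n, cf_id = (\<lambda>v. v), cf_port = (\<lambda>v p. if p < v then p else Suc p),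
      cf_edges = E, cf_weight = w, cf_mark = mark\<rparr>"

lemma standard_config_simps [simp]:
  "cf_size (standard_config n E w mark) = n"
  "cf_id (standard_config n E w mark) = (\<lambda>v. v)"
  "cf_port (standard_config n E w mark) = (\<lambda>v p. if p < v then p else Suc p)"
  "cf_edges (standard_config n E w mark) = E"
  "cf_weight (standard_config n E w mark) = w"
  "cf_mark (standard_config n E w mark) = mark"
  by (simp_all add: standard_config_def)

text \<open>Node names serve as identifiers and stay within \<open>n ^ k\<close> as \<open>k\<close>
  is at least \<open>1\<close>. The ports of \<open>v\<close> list the other nodes in increasing
  order, skipping \<open>v\<close>.\<close>

lemma standard_config_in_family:
  assumes "k \<ge> 1" "n \<ge> 1" "E \<subseteq> {{u, v} | u v. u < n \<and> v < n \<and> u \<noteq> v}"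
    and "\<And>u v. mark u v \<Longrightarrow> {u, v} \<in> E" and "\<And>e. e \<in> E \<Longrightarrow> w e \<le> wmax"
  shows "standard_config n E w mark \<in> mst_family k wmax"
proof -
  have "v \<le> n ^ k" if "v < n" for v
  proof -
    have "n ^ 1 \<le> n ^ k" using assms by (intro power_increasing) auto
    then show ?thesis using that by simp
  qed
  moreover have "bij_betw (\<lambda>p. if p < v then p else Suc p) {..<n - 1} ({..<n} - {v})"
    if "v < n" for v
    by (rule bij_betw_byWitness[where f' = "\<lambda>u. if u < v then u else u - 1"]) (use that in auto)
  ultimately show ?thesis
    using assms by (simp add: mst_family_def wf_config_def)
qed

lemma state_of_standard_eqI:
  assumes "\<And>u. {v, u} \<in> E \<Longrightarrow> w {v, u} = w' {v, u} \<and> mark v u = mark' v u"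
  shows "state_of (standard_config n E w mark) v = state_of (standard_config n E w' mark') v"
  using assms by (simp add: state_of_def Let_def)

definition parent_forest :: "nat \<Rightarrow> (nat \<Rightarrow> nat) \<Rightarrow> nat set set" where
  "parent_forest n par = {{v, par v} | v. v < n \<and> par v \<noteq> v}"

definition parent_mark :: "nat \<Rightarrow> (nat \<Rightarrow> nat) \<Rightarrow> nat \<Rightarrow> nat \<Rightarrow> bool" where
  "parent_mark n par u v \<longleftrightarrow> u \<noteq> v \<and> (u < n \<and> par u = v \<or> v < n \<and> par v = u)"

lemma parent_forest_iff: "{u, v} \<in> parent_forest n par \<longleftrightarrow> parent_mark n par u v"
  by (auto simp: parent_forest_def parent_mark_def doubleton_eq_iff)

lemma parent_mark_commute: "parent_mark n par u v \<longleftrightarrow> parent_mark n par v u"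
  by (auto simp: parent_mark_def)

lemma cf_tree_standard: "cf_tree (standard_config n E w (parent_mark n par)) = parent_forest n par"
  unfolding cf_tree_def standard_config_simps parent_forest_iff[symmetric]
  by (auto simp: parent_forest_def)

lemma linked_invariant:
  assumes "linked F u v" "u \<in> X" and "\<And>a b. {a, b} \<in> F \<Longrightarrow> a \<in> X \<Longrightarrow> b \<in> X"
  shows "v \<in> X"
  using assms(1)
proof (induction rule: rtrancl_induct)
  case (step y z)
  then show ?case using assms(3)[of y z] by (simp add: edge_rel_def)
qed (rule assms(2))

text \<open>Parents are never larger, so following them from \<open>par a\<close> cannot lead back
  to \<open>a\<close> if \<open>par a\<close> differs from \<open>a\<close>. The descendants of
  \<open>a\<close>, collected in \<open>X\<close>, are therefore cut off from \<open>par a\<close>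
  once the edge between \<open>a\<close> and \<open>par a\<close> is removed.\<close>

lemma parent_forest_all_bridges:
  assumes par: "\<And>v. par v \<le> v"
  shows "all_bridges (parent_forest n par)"
proof -
  have no_link: "\<not> linked (parent_forest n par - {{a, par a}}) a (par a)" if "par a \<noteq> a" for a
  proof
    assume l: "linked (parent_forest n par - {{a, par a}}) a (par a)"
    define X where "X = {x. \<exists>j. (par ^^ j) x = a}"
    have up: "par v \<in> X \<longleftrightarrow> v \<in> X" if "v \<noteq> a" for v
    proof
      assume "par v \<in> X"
      then obtain j where "(par ^^ j) (par v) = a" by (auto simp: X_def)
      then have "(par ^^ Suc j) v = a" by (simp only: funpow_Suc_right o_apply)
      then show "v \<in> X" unfolding X_def by blast
    next
      assume "v \<in> X"
      then obtain j where j: "(par ^^ j) v = a" by (auto simp: X_def)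
      then obtain i where "j = Suc i" using \<open>v \<noteq> a\<close> by (cases j) auto
      then have "(par ^^ i) (par v) = a" using j by (simp only: funpow_Suc_right o_apply)
      then show "par v \<in> X" unfolding X_def by blast
    qed
    have "(par ^^ 0) a = a" by simp
    then have "a \<in> X" unfolding X_def by blast
    with l have "par a \<in> X"
    proof (rule linked_invariant)
      fix c d assume cd: "{c, d} \<in> parent_forest n par - {{a, par a}}" and c: "c \<in> X"
      then have "{c, d} \<noteq> {a, par a}" "parent_mark n par c d" by (auto simp: parent_forest_iff)
      then have "c \<noteq> a \<and> par c = d \<or> d \<noteq> a \<and> par d = c"
        by (auto simp: parent_mark_def doubleton_eq_iff)
      then show "d \<in> X" using up[of c] up[of d] c by blast
    qed
    then obtain j where "(par ^^ j) (par a) = a" by (auto simp: X_def)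
    moreover have "(par ^^ j) x \<le> x" for x
      by (induction j) (auto intro: le_trans[OF par])
    ultimately have "a \<le> par a" by metis
    then show False using par[of a] that by simp
  qed
  show ?thesis
    unfolding all_bridges_def
  proof (intro allI impI)
    fix a b assume "{a, b} \<in> parent_forest n par"
    then have "a \<noteq> b" "par a = b \<or> par b = a" by (auto simp: parent_forest_iff parent_mark_def)
    then show "\<not> linked (parent_forest n par - {{a, b}}) a b"
    proof (elim disjE)
      assume "par a = b"
      then show ?thesis using no_link[of a] \<open>a \<noteq> b\<close> by simp
    next
      assume "par b = a"
      then show ?thesis
        using no_link[of b] \<open>a \<noteq> b\<close> linked_sym[of a b] by (simp add: insert_commute) blast
    qed
  qed
qed

lemma mst_predicate_parent:
  assumes "standard_config n E w (parent_mark n par) \<in> mst_family k wmax"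
    and par: "\<And>v. par v \<le> v"
    and l: "\<And>u v. {u, v} \<in> E \<Longrightarrow> linked {f \<in> parent_forest n par. w f \<le> w {u, v}} u v"
  shows "mst_predicate (standard_config n E w (parent_mark n par))"
proof -
  let ?C = "standard_config n E w (parent_mark n par)"
  have wf: "wf_config k ?C" using assms(1) by (simp add: mst_family_def)
  have "cf_tree ?C \<subseteq> E"
  proof
    fix e assume "e \<in> cf_tree ?C"
    then obtain u v where "e = {u, v}" "cf_mark ?C u v" unfolding cf_tree_def by blast
    moreover have "cf_mark ?C u v \<longrightarrow> {u, v} \<in> cf_edges ?C" for u v
      using wf unfolding wf_config_def by blast
    ultimately show "e \<in> E" by simp
  qed
  then have "msf_criterion E w (parent_forest n par)"
    using parent_forest_all_bridges[OF par] l by (simp add: msf_criterion_def cf_tree_standard)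
  then show ?thesis
    using parent_mark_commute by (simp add: mst_predicate_iff[OF wf] cf_tree_standard)
qed

subsection \<open>Spanning trees of the complete graph\<close>

definition clique_edges :: "nat \<Rightarrow> nat set set" where
  "clique_edges n = {{u, v} | u v. u < n \<and> v < n \<and> u \<noteq> v}"

text \<open>For positive \<open>m\<close>, the nodes below \<open>m\<close> form a fixed star with
  centre and root \<open>0\<close>; all freedom lies in where the nodes from \<open>m\<close> on are
  hung.\<close>

definition hub_parent :: "nat \<Rightarrow> (nat \<Rightarrow> nat) \<Rightarrow> nat \<Rightarrow> nat" where
  "hub_parent m f v = (if m \<le> v then f v else 0)"

lemma tree_lower_bound:
  assumes k: "k \<ge> 1" and S: "is_pls (mst_family k wmax) mst_predicate S"
    and L: "pls_complexity (mst_family k wmax) mst_predicate S n \<le> enat L"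
    and m: "1 \<le> m" "m \<le> n"
  shows "m ^ (n - m) \<le> 2 ^ ((L + 1) * n)"
proof -
  define X where "X = {m..<n} \<rightarrow>\<^sub>E {..<m}"
  \<comment> \<open>Outside the graph \<open>f\<close> is \<open>undefined\<close>; the identity
    there keeps \<open>par f v \<le> v\<close> true for all \<open>v\<close>.\<close>
  define par where "par f v = (if v < n then hub_parent m f v else v)" for f v
  define conf where "conf f = standard_config n (clique_edges n) (\<lambda>_. 0) (parent_mark n (par f))" for f
  have val: "f v < m" if "f \<in> X" "m \<le> v" "v < n" for f v
    using that by (auto simp: X_def)
  have par_less: "par f v < m" if "f \<in> X" "v < n" for f v
    using val[OF that(1), of v] that(2) m by (auto simp: par_def hub_parent_def)
  have par_lt: "par f v < v" if "f \<in> X" "v < n" "0 < v" for f v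
    using val[OF that(1), of v] that m by (auto simp: par_def hub_parent_def)
  have par_le: "par f v \<le> v" if "f \<in> X" for f v
  proof (cases "v < n \<and> 0 < v")
    case True
    then show ?thesis using par_lt[OF that] less_imp_le by blast
  next
    case False
    then show ?thesis using m by (auto simp: par_def hub_parent_def)
  qed
  have par_bound: "par f v < n" if "f \<in> X" "v < n" for f v
    using par_less[OF that] m by simp
  have mark_edge: "{u, v} \<in> clique_edges n" if "f \<in> X" "parent_mark n (par f) u v" for f u v
    using that par_bound[OF that(1)] unfolding parent_mark_def clique_edges_def by blast
  have fam: "conf f \<in> mst_family k wmax" if f: "f \<in> X" for f
    unfolding conf_def
    by (rule standard_config_in_family)
      (use k m mark_edge[OF f] in \<open>auto simp: clique_edges_def\<close>)
  have legal: "mst_predicate (conf f)" if f: "f \<in> X" for f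
    unfolding conf_def
  proof (rule mst_predicate_parent)
    show "standard_config n (clique_edges n) (\<lambda>_. 0) (parent_mark n (par f)) \<in> mst_family k wmax"
      using fam[OF f] by (simp add: conf_def)
    have root: "linked (parent_forest n (par f)) v 0" if "v < n" for v
      using that
    proof (induction v rule: less_induct)
      case (less v)
      show ?case
      proof (cases "v = 0")
        case False
        then have lt: "par f v < v" using par_lt[OF f less.prems] by simp
        then have "linked (parent_forest n (par f)) v (par f v)"
          using less.prems by (intro linked_edge) (simp add: parent_forest_iff parent_mark_def)
        moreover have "linked (parent_forest n (par f)) (par f v) 0"
          using lt less.prems by (intro less.IH) auto
        ultimately show ?thesis by (rule linked_trans)
      qed simp
    qed
    fix u v assume "{u, v} \<in> clique_edges n"
    then have "u < n" "v < n" by (auto simp: clique_edges_def doubleton_eq_iff)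
    then have "linked (parent_forest n (par f)) u v"
      using linked_trans[OF root linked_sym[OF root]] by blast
    then show "linked {g \<in> parent_forest n (par f). 0 \<le> (0 :: nat)} u v" by simp
  qed (rule par_le[OF f])
  have "card X \<le> 2 ^ ((L + 1) * n)"
  proof (rule message_counting[where conf = conf, OF _ L])
    show "conf f \<in> mst_family k wmax \<and> mst_predicate (conf f) \<and> cf_size (conf f) = n" if "f \<in> X" for f
      using fam[OF that] legal[OF that] by (simp add: conf_def)
    fix f g assume f: "f \<in> X" and g: "g \<in> X"
      and msg: "\<And>v. v < n \<Longrightarrow> sent_message S (conf f) (pls_prover S (conf f)) v =
        sent_message S (conf g) (pls_prover S (conf g)) v"
    show "f = g"
    proof (rule ccontr)
      assume "f \<noteq> g"
      then obtain v where "v \<in> {m..<n}" "f v \<noteq> g v"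
        using PiE_ext f g unfolding X_def by metis
      then have v: "m \<le> v" "v < n" "f v \<noteq> g v" by auto
      \<comment> \<open>Node \<open>v\<close> reports the tree of \<open>g\<close>, all others that
        of \<open>f\<close>. So \<open>f v\<close> marks its edge to \<open>v\<close>, but
        \<open>v\<close> does not: in the tree of \<open>g\<close> its parent is \<open>g v\<close>,
        and the parent of \<open>f v\<close>, a node below \<open>m\<close>, is
        \<open>0\<close>.\<close>
      define H where "H = standard_config n (clique_edges n) (\<lambda>_. 0)
        (\<lambda>u. if u = v then parent_mark n (par g) u else parent_mark n (par f) u)"
      have "H \<in> mst_family k wmax"
        unfolding H_def
        by (rule standard_config_in_family)
          (use k m mark_edge[OF f] mark_edge[OF g] in \<open>auto simp: clique_edges_def split: if_splits\<close>)
      then have "mst_predicate H"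
      proof (rule hybrid_legal[OF S fam[OF f] legal[OF f] fam[OF g] legal[OF g], where A = "{v}"])
        fix u assume "u < cf_size H"
        then show "sent_message S (conf f) (pls_prover S (conf f)) u =
            sent_message S (conf g) (pls_prover S (conf g)) u"
          by (intro msg) (simp add: H_def)
        show "state_of H u = state_of (conf g) u" if "u \<in> {v}"
          unfolding H_def conf_def by (rule state_of_standard_eqI) (use that in simp)
        show "state_of H u = state_of (conf f) u" if "u \<notin> {v}"
          unfolding H_def conf_def by (rule state_of_standard_eqI) (use that in simp)
      qed (auto simp: H_def conf_def)
      moreover have "f v < m" using val[OF f] v by blast
      then have fv: "f v < n" "f v \<noteq> v" using v m by auto
      then have "{f v, v} \<in> cf_edges H" unfolding H_def clique_edges_def using v by auto
      ultimately have "cf_mark H (f v) v = cf_mark H v (f v)" by (simp add: mst_predicate_def)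
      moreover have "cf_mark H (f v) v"
        using fv v by (simp add: H_def parent_mark_def par_def hub_parent_def)
      moreover have "\<not> cf_mark H v (f v)"
        using fv v \<open>f v < m\<close> m by (simp add: H_def parent_mark_def par_def hub_parent_def)
      ultimately show False by simp
    qed
  qed
  moreover have "card X = m ^ (n - m)" by (simp add: X_def card_PiE)
  ultimately show ?thesis by simp
qed

subsection \<open>Disjoint four-cycles\<close>

text \<open>
  The cycle on \<open>4 j, \<dots>, 4 j + 3\<close> consists of the non-tree edge \<open>{4 j, 4 j + 3}\<close> and a path of tree
  edges, in which the middle edge \<open>{4 j + 1, 4 j + 2}\<close> has no node in common with the non-tree edge.
  Hence no node sees the weights of both.
\<close>

definition cycle_parent :: "nat \<Rightarrow> nat \<Rightarrow> nat" where
  "cycle_parent n v = (if v < 4 * (n div 4) \<and> v mod 4 \<noteq> 0 then v - 1 else v)"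

definition cycle_edges :: "nat \<Rightarrow> nat set set" where
  "cycle_edges n =
     parent_forest n (cycle_parent n) \<union> {{4 * j, 4 * j + 3} | j. j < n div 4}"

text \<open>A difference of \<open>3\<close> between the ends singles out the non-tree edges, and a
  smaller end congruent to \<open>1\<close> modulo \<open>4\<close> the middle edges. The two
  weightings coincide in the configurations that are counted; they are separate arguments so that
  mixtures have the same form.\<close>

definition cycle_weight :: "(nat \<Rightarrow> nat) \<Rightarrow> (nat \<Rightarrow> nat) \<Rightarrow> nat set \<Rightarrow> nat" where
  "cycle_weight outer mid e =
     (if Max e = Min e + 3 then outer (Min e div 4)
      else if Min e mod 4 = 1 then mid (Min e div 4) else 0)"

lemma cycle_weight_outer: "cycle_weight f g {4 * j, 4 * j + 3} = f j"
  by (simp add: cycle_weight_def)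

lemma cycle_weight_path:
  "cycle_weight f g {v, Suc v} = (if v mod 4 = 1 then g (v div 4) else 0)"
  by (simp add: cycle_weight_def)

lemma cycle_parent_mark_iff:
  "parent_mark n (cycle_parent n) u v \<longleftrightarrow>
    (\<exists>x. {u, v} = {x, Suc x} \<and> Suc x < 4 * (n div 4) \<and> x mod 4 \<noteq> 3)"
proof
  assume "parent_mark n (cycle_parent n) u v"
  then have "u \<noteq> v" "cycle_parent n u = v \<or> cycle_parent n v = u"
    by (auto simp: parent_mark_def)
  moreover have "\<exists>x. {a, b} = {x, Suc x} \<and> Suc x < 4 * (n div 4) \<and> x mod 4 \<noteq> 3"
    if "cycle_parent n a = b" "a \<noteq> b" for a b
  proof -
    have a: "a < 4 * (n div 4)" "a mod 4 \<noteq> 0" "b = a - 1"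
      using that by (auto simp: cycle_parent_def split: if_splits)
    then have "a = Suc b" "b mod 4 \<noteq> 3" by (cases a; simp; presburger)+
    then show ?thesis using a by (intro exI[of _ b]) auto
  qed
  ultimately show "\<exists>x. {u, v} = {x, Suc x} \<and> Suc x < 4 * (n div 4) \<and> x mod 4 \<noteq> 3"
    by (metis insert_commute)
next
  assume "\<exists>x. {u, v} = {x, Suc x} \<and> Suc x < 4 * (n div 4) \<and> x mod 4 \<noteq> 3"
  then obtain x where x: "{u, v} = {x, Suc x}" "Suc x < 4 * (n div 4)" "x mod 4 \<noteq> 3" by blast
  have "Suc x mod 4 \<noteq> 0" using x(3) by presburger
  then have "cycle_parent n (Suc x) = x" using x by (simp add: cycle_parent_def)
  moreover have "Suc x < n" using x(2) by linarith
  ultimately show "parent_mark n (cycle_parent n) u v"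
    using x(1) by (auto simp: parent_mark_def doubleton_eq_iff)
qed

lemma cycle_edges_cases:
  assumes "{u, v} \<in> cycle_edges n"
  obtains j where "j < n div 4" "{u, v} = {4 * j, 4 * j + 3}"
  | x where "{u, v} = {x, Suc x}" "Suc x < 4 * (n div 4)" "x mod 4 \<noteq> 3"
  using assms unfolding cycle_edges_def Un_iff parent_forest_iff cycle_parent_mark_iff by blast

lemma cycle_edges_subset: "cycle_edges n \<subseteq> {{u, v} | u v. u < n \<and> v < n \<and> u \<noteq> v}"
proof
  fix e assume e: "e \<in> cycle_edges n"
  then obtain u v where uv: "e = {u, v}" by (auto simp: cycle_edges_def parent_forest_def)
  have "\<exists>a b. e = {a, b} \<and> a < n \<and> b < n \<and> a \<noteq> b"
  proof (rule cycle_edges_cases[OF e[unfolded uv]])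
    fix j assume j: "j < n div 4" "{u, v} = {4 * j, 4 * j + 3}"
    then have "4 * j + 3 < n" by linarith
    then show ?thesis using uv j(2) by (intro exI[of _ "4 * j"] exI[of _ "4 * j + 3"]) auto
  next
    fix x assume x: "{u, v} = {x, Suc x}" "Suc x < 4 * (n div 4)"
    then have "Suc x < n" by linarith
    then show ?thesis using uv x(1) by (intro exI[of _ x] exI[of _ "Suc x"]) auto
  qed
  then show "e \<in> {{u, v} | u v. u < n \<and> v < n \<and> u \<noteq> v}" by simp
qed

lemma cycle_lower_bound:
  assumes k: "k \<ge> 1" and n: "n \<ge> 1" and S: "is_pls (mst_family k wmax) mst_predicate S"
    and L: "pls_complexity (mst_family k wmax) mst_predicate S n \<le> enat L"
  shows "wmax ^ (n div 4) \<le> 2 ^ ((L + 1) * n)"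
proof -
  define X where "X = {..<n div 4} \<rightarrow>\<^sub>E {..<wmax}"
  define tree where "tree = parent_forest n (cycle_parent n)"
  define conf where "conf f g = standard_config n (cycle_edges n) (cycle_weight f g)
    (parent_mark n (cycle_parent n))" for f g
  have tree_iff: "{u, v} \<in> tree \<longleftrightarrow>
      (\<exists>x. {u, v} = {x, Suc x} \<and> Suc x < 4 * (n div 4) \<and> x mod 4 \<noteq> 3)" for u v
    unfolding tree_def parent_forest_iff by (rule cycle_parent_mark_iff)
  have tree_edge: "tree \<subseteq> cycle_edges n" by (simp add: tree_def cycle_edges_def)
  have val: "f j \<le> wmax" if "f \<in> X" "j < n div 4" for f j
    using that by (auto simp: X_def PiE_iff intro: less_imp_le)
  have fam: "conf f g \<in> mst_family k wmax"
    if f: "\<And>j. j < n div 4 \<Longrightarrow> f j \<le> wmax" and g: "\<And>j. j < n div 4 \<Longrightarrow> g j \<le> wmax" for f g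
    unfolding conf_def
  proof (rule standard_config_in_family[OF k n cycle_edges_subset])
    show "{u, v} \<in> cycle_edges n" if "parent_mark n (cycle_parent n) u v" for u v
      using that by (simp add: cycle_edges_def parent_forest_iff)
    fix e assume e: "e \<in> cycle_edges n"
    then obtain u v where uv: "e = {u, v}" by (auto simp: cycle_edges_def parent_forest_def)
    show "cycle_weight f g e \<le> wmax"
    proof (rule cycle_edges_cases[OF e[unfolded uv]])
      fix j assume "j < n div 4" "{u, v} = {4 * j, 4 * j + 3}"
      then show ?thesis using f uv cycle_weight_outer by simp
    next
      fix x assume x: "{u, v} = {x, Suc x}" "Suc x < 4 * (n div 4)"
      then have "x div 4 < n div 4" by linarith
      then show ?thesis using g uv x(1) cycle_weight_path by simp
    qed
  qed
  have famX: "conf f f \<in> mst_family k wmax" if "f \<in> X" for f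
    using val[OF that] by (intro fam)
  have legal: "mst_predicate (conf f f)" if f: "f \<in> X" for f
    unfolding conf_def
  proof (rule mst_predicate_parent)
    show "standard_config n (cycle_edges n) (cycle_weight f f) (parent_mark n (cycle_parent n))
        \<in> mst_family k wmax"
      using famX[OF f] by (simp add: conf_def)
    show "cycle_parent n v \<le> v" for v by (simp add: cycle_parent_def)
    fix u v assume "{u, v} \<in> cycle_edges n"
    then have "linked {e \<in> tree. cycle_weight f f e \<le> cycle_weight f f {u, v}} u v"
    proof (cases rule: cycle_edges_cases)
      case (1 j)
      define F where "F = {e \<in> tree. cycle_weight f f e \<le> cycle_weight f f {u, v}}"
      have "linked F (4 * j + i) (Suc (4 * j + i))" if "i < 3" for i
      proof (rule linked_edge)
        have "(4 * j + i) mod 4 = i" and d: "(4 * j + i) div 4 = j" using that by simp_all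
        moreover have "Suc (4 * j + i) < 4 * (n div 4)" using 1(1) that by linarith
        ultimately have "{4 * j + i, Suc (4 * j + i)} \<in> tree"
          unfolding tree_iff using that by (intro exI[of _ "4 * j + i"]) simp
        moreover have "cycle_weight f f {4 * j + i, Suc (4 * j + i)} \<le> f j"
          unfolding cycle_weight_path d by simp
        ultimately show "{4 * j + i, Suc (4 * j + i)} \<in> F"
          unfolding F_def 1(2) cycle_weight_outer by blast
      qed
      from this[of 0] this[of 1] this[of 2]
      have "linked F (4 * j) (Suc (4 * j))" "linked F (Suc (4 * j)) (4 * j + 2)"
        "linked F (4 * j + 2) (4 * j + 3)"
        by (simp_all add: numeral_eq_Suc)
      then have "linked F (4 * j) (4 * j + 3)" by (meson linked_trans)
      moreover from this have "linked F (4 * j + 3) (4 * j)" by (rule linked_sym)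
      ultimately have "linked F u v" using 1(2) by (auto simp: doubleton_eq_iff)
      then show ?thesis unfolding F_def .
    next
      case (2 x)
      then have "{u, v} \<in> tree" unfolding tree_iff by blast
      then show ?thesis by (intro linked_edge) simp
    qed
    then show "linked {e \<in> parent_forest n (cycle_parent n).
        cycle_weight f f e \<le> cycle_weight f f {u, v}} u v"
      by (simp add: tree_def)
  qed
  \<comment> \<open>Only a middle edge heavier than the outer one is a defect, so one strict
    inequality is refuted at a time; exchanging \<open>f\<close> and \<open>g\<close> excludes the
    other.\<close>
  have not_less: "\<not> f j < g j"
    if f: "f \<in> X" and g: "g \<in> X" and j: "j < n div 4"
      and msg: "\<And>v. v < n \<Longrightarrow> sent_message S (conf f f) (pls_prover S (conf f f)) v =
        sent_message S (conf g g) (pls_prover S (conf g g)) v" for f g j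
  proof
    assume less: "f j < g j"
    \<comment> \<open>The nodes of \<open>?A\<close> take their states from \<open>g\<close>. They
      are the two ends of the middle edge and lie on no outer edge, so both ends of every edge still
      report the same weight.\<close>
    define H where "H = conf f (f(j := g j))"
    let ?A = "{4 * j + 1, 4 * j + 2}"
    have H: "H \<in> mst_family k wmax"
      unfolding H_def using val[OF f] val[OF g] by (intro fam) auto
    then have "mst_predicate H"
    proof (rule hybrid_legal[OF S famX[OF f] legal[OF f] famX[OF g] legal[OF g], where A = ?A])
      fix v assume "v < cf_size H"
      then show "sent_message S (conf f f) (pls_prover S (conf f f)) v =
          sent_message S (conf g g) (pls_prover S (conf g g)) v"
        by (intro msg) (simp add: H_def conf_def)
      show "state_of H v = state_of (conf g g) v" if v: "v \<in> ?A"
        unfolding H_def conf_def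
      proof (rule state_of_standard_eqI)
        fix u assume "{v, u} \<in> cycle_edges n"
        then have "cycle_weight f (f(j := g j)) {v, u} = cycle_weight g g {v, u}"
        proof (cases rule: cycle_edges_cases)
          case (1 i)
          then have "v = 4 * i \<or> v = 4 * i + 3" by (auto simp: doubleton_eq_iff)
          then have False using v by simp presburger
          then show ?thesis ..
        next
          case (2 x)
          then have "v = x \<or> v = Suc x" by (auto simp: doubleton_eq_iff)
          then have "x mod 4 = 1 \<Longrightarrow> x div 4 = j" using v by auto
          then show ?thesis unfolding 2(1) cycle_weight_path by simp
        qed
        then show "cycle_weight f (f(j := g j)) {v, u} = cycle_weight g g {v, u} \<and>
            parent_mark n (cycle_parent n) v u = parent_mark n (cycle_parent n) v u" by simp
      qed
      show "state_of H v = state_of (conf f f) v" if v: "v \<notin> ?A"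
        unfolding H_def conf_def
      proof (rule state_of_standard_eqI)
        fix u assume "{v, u} \<in> cycle_edges n"
        then have "cycle_weight f (f(j := g j)) {v, u} = cycle_weight f f {v, u}"
        proof (cases rule: cycle_edges_cases)
          case (1 i)
          then show ?thesis by (simp only: cycle_weight_outer)
        next
          case (2 x)
          then have "v = x \<or> v = Suc x" by (auto simp: doubleton_eq_iff)
          then have "x mod 4 = 1 \<Longrightarrow> x div 4 \<noteq> j" using v by auto presburger+
          then show ?thesis unfolding 2(1) cycle_weight_path by simp
        qed
        then show "cycle_weight f (f(j := g j)) {v, u} = cycle_weight f f {v, u} \<and>
            parent_mark n (cycle_parent n) v u = parent_mark n (cycle_parent n) v u" by simp
      qed
    qed (auto simp: H_def conf_def)
    moreover have "wf_config k H" using H by (simp add: mst_family_def)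
    ultimately have crit: "msf_criterion (cycle_edges n) (cycle_weight f (f(j := g j))) tree"
      unfolding tree_def H_def conf_def
      by (simp add: mst_predicate_iff cf_tree_standard)
    let ?w = "cycle_weight f (f(j := g j))"
    have "{4 * j, 4 * j + 3} \<in> cycle_edges n" using j unfolding cycle_edges_def by blast
    from msf_criterionD(3)[OF crit this]
    have "linked {e \<in> tree. ?w e \<le> f j} (4 * j) (4 * j + 3)"
      by (simp only: cycle_weight_outer)
    \<comment> \<open>The part of the path before the middle edge is closed under tree edges of
      weight at most \<open>f j\<close>.\<close>
    then have "4 * j + 3 \<in> {4 * j, 4 * j + 1}"
    proof (rule linked_invariant)
      fix a b assume ab: "{a, b} \<in> {e \<in> tree. ?w e \<le> f j}" and a: "a \<in> {4 * j, 4 * j + 1}"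
      then obtain x where x: "{a, b} = {x, Suc x}" "x mod 4 \<noteq> 3" using tree_iff by blast
      have "x \<noteq> 4 * j + 1"
      proof
        assume "x = 4 * j + 1"
        then have "x mod 4 = 1" "x div 4 = j" by simp_all
        then have "?w {a, b} = g j" unfolding x(1) cycle_weight_path by simp
        then show False using ab less by simp
      qed
      moreover have "a = x \<and> b = Suc x \<or> a = Suc x \<and> b = x"
        using x(1) by (auto simp: doubleton_eq_iff)
      moreover have "Suc x \<noteq> 4 * j" using x(2) by presburger
      ultimately show "b \<in> {4 * j, 4 * j + 1}" using a by auto
    qed simp
    then show False by simp
  qed
  have "card X \<le> 2 ^ ((L + 1) * n)"
  proof (rule message_counting[where conf = "\<lambda>f. conf f f", OF _ L])
    show "conf f f \<in> mst_family k wmax \<and> mst_predicate (conf f f) \<and> cf_size (conf f f) = n"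
      if "f \<in> X" for f
      using famX[OF that] legal[OF that] by (simp add: conf_def)
    fix f g assume f: "f \<in> X" and g: "g \<in> X"
      and msg: "\<And>v. v < n \<Longrightarrow> sent_message S (conf f f) (pls_prover S (conf f f)) v =
        sent_message S (conf g g) (pls_prover S (conf g g)) v"
    have "f j = g j" if "j < n div 4" for j
      using not_less[OF f g that msg] not_less[OF g f that msg[symmetric]] by simp
    then show "f = g" using f g unfolding X_def by (intro PiE_ext[of f _ _ g]) auto
  qed
  moreover have "card X = wmax ^ (n div 4)" by (simp add: X_def card_PiE)
  ultimately show ?thesis by simp
qed

section \<open>Numerical conclusion\<close>

lemma verification_complexity_lower:
  assumes k: "k \<ge> 1" and n: "n \<ge> 256" and w: "wmax \<ge> 1"
    and S: "is_pls (mst_family k wmax) mst_predicate S"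
    and L: "pls_complexity (mst_family k wmax) mst_predicate S n \<le> enat L"
  shows "1 / 16 * (log 2 (real n) + log 2 (real wmax)) \<le> real L"
proof -
  \<comment> \<open>From \<open>2 ^ 8\<close> on, the bound obtained from trees gives
    \<open>L \<ge> 2\<close>, which is enough to absorb the additive constants.\<close>
  have "real n \<ge> 2 powr 8" using n by simp
  then have n8: "8 \<le> log 2 (real n)" using n by (subst le_log_iff) auto
  let ?m = "n div 2"
  have "?m ^ (n - ?m) \<le> 2 ^ ((L + 1) * n)"
    using n by (intro tree_lower_bound[OF k S L]) auto
  then have "real (?m ^ (n - ?m)) \<le> real (2 ^ ((L + 1) * n))" by (simp only: of_nat_le_iff)
  then have "log 2 (real ?m ^ (n - ?m)) \<le> log 2 (2 ^ ((L + 1) * n))"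
    using n by (subst log_le_cancel_iff) auto
  then have "real (n - ?m) * log 2 (real ?m) \<le> real ((L + 1) * n)"
    using n by (simp add: log_nat_power del: of_nat_mult)
  moreover have "real n / 2 * log 2 (real ?m) \<le> real (n - ?m) * log 2 (real ?m)"
    using n by (intro mult_right_mono) auto
  ultimately have "real n * (log 2 (real ?m) / 2) \<le> real n * (real L + 1)"
    by (simp add: algebra_simps)
  then have m: "log 2 (real ?m) / 2 \<le> real L + 1" using n by (subst (asm) mult_le_cancel_left_pos) auto
  have "real n / 4 \<le> real ?m" using n by linarith
  then have "log 2 (real n / 4) \<le> log 2 (real ?m)" using n by (subst log_le_cancel_iff) auto
  moreover have "log 2 (real n / 4) = log 2 (real n) - 2"
    using n log_pow_cancel[of 2 2] by (simp add: log_divide)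
  ultimately have tree: "log 2 (real n) \<le> 2 * real L + 4" using m by linarith
  let ?q = "n div 4"
  have "wmax ^ ?q \<le> 2 ^ ((L + 1) * n)"
    using n by (intro cycle_lower_bound[OF k _ S L]) auto
  then have "real (wmax ^ ?q) \<le> real (2 ^ ((L + 1) * n))" by (simp only: of_nat_le_iff)
  then have "log 2 (real wmax ^ ?q) \<le> log 2 (2 ^ ((L + 1) * n))"
    using w by (subst log_le_cancel_iff) auto
  then have "real ?q * log 2 (real wmax) \<le> real ((L + 1) * n)"
    using w by (simp add: log_nat_power del: of_nat_mult)
  moreover have "real n / 8 * log 2 (real wmax) \<le> real ?q * log 2 (real wmax)"
    using n w by (intro mult_right_mono) auto
  ultimately have "real n * (log 2 (real wmax) / 8) \<le> real n * (real L + 1)"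
    by (simp add: algebra_simps)
  then have "log 2 (real wmax) / 8 \<le> real L + 1" using n by (subst (asm) mult_le_cancel_left_pos) auto
  \<comment> \<open>The bounds \<open>2 * L + 4\<close> and \<open>8 * L + 8\<close> add up to
    \<open>10 * L + 12\<close>, at most \<open>16 * L\<close> for \<open>L \<ge> 2\<close>; hence
    the factor \<open>1 / 16\<close>.\<close>
  then show ?thesis using tree n8 by simp
qed

theorem theorem6:
  fixes k :: nat
  assumes "k \<ge> 1"
  shows "\<exists>a b :: real. \<exists>N :: nat. a > 0 \<and> b > 0 \<and>
    (\<forall>n \<ge> N. \<forall>wmax \<ge> 1.
       ereal (a * (log 2 (real n) + log 2 (real wmax)))
         \<le> ereal_of_enat (verification_complexity (mst_family k wmax) mst_predicate n) \<and>
       ereal_of_enat (verification_complexity (mst_family k wmax) mst_predicate n)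
         \<le> ereal (b * (log 2 (real n) + log 2 (real wmax))))"
proof (intro exI conjI allI impI)
  show "(0 :: real) < 1 / 16" "0 < 2 * real k + 4" by simp_all
  fix n wmax :: nat assume n: "256 \<le> n" and w: "1 \<le> wmax"
  let ?vc = "verification_complexity (mst_family k wmax) mst_predicate n"
  let ?X = "{pls_complexity (mst_family k wmax) mst_predicate S n | S.
    is_pls (mst_family k wmax) mst_predicate S}"
  have upper: "?vc \<le> enat (certificate_bits k wmax n)" by (rule verification_complexity_upper)
  \<comment> \<open>The scheme rules out the value \<open>\<infinity>\<close>.\<close>
  then obtain L where L: "?vc = enat L" by (cases ?vc) auto
  have "pls_complexity (mst_family k wmax) mst_predicate (mst_scheme k wmax) n \<in> ?X"
    using mst_scheme_is_pls by blast
  \<comment> \<open>A nonempty set of extended naturals has a least element, so a single scheme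
    attains the infimum for this \<open>n\<close>, and the lower bound applies to it.\<close>
  then have "Inf ?X \<in> ?X" by (rule wellorder_InfI)
  then obtain S where "is_pls (mst_family k wmax) mst_predicate S"
    "Inf ?X = pls_complexity (mst_family k wmax) mst_predicate S n" by blast
  with L have "is_pls (mst_family k wmax) mst_predicate S"
    "pls_complexity (mst_family k wmax) mst_predicate S n \<le> enat L"
    by (simp_all add: verification_complexity_def)
  then have "1 / 16 * (log 2 (real n) + log 2 (real wmax)) \<le> real L"
    by (rule verification_complexity_lower[OF assms n w])
  then show "ereal (1 / 16 * (log 2 (real n) + log 2 (real wmax))) \<le> ereal_of_enat ?vc"
    by (simp add: L)
  have "real L \<le> real (certificate_bits k wmax n)" using upper L by simp
  also have "\<dots> \<le> (2 * real k + 4) * (log 2 (real n) + log 2 (real wmax))"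
    using n w by (intro certificate_bits_le) auto
  finally show "ereal_of_enat ?vc \<le> ereal ((2 * real k + 4) * (log 2 (real n) + log 2 (real wmax)))"
    by (simp add: L)
qed

end
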